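(* Let $\mathcal{K}$ be a category of posets $\mathcal{C}$, each equipped with a subcanonical Grothendieck topology $J_{\mathcal{C}}$, whose arrows are monotone maps which are morphisms of the associated sites. Suppose that $\mathcal{K}$ contains, among its objects, all the frames, and that for any $\mathcal{C}$ in $\mathcal{K}$ and any frame $L$ in $\mathcal{K}$ the arrows $\mathcal{C}\to L$ in $\mathcal{K}$ coincide with the filtering maps $\mathcal{C}\to L$ which send $J_{\mathcal{C}}$-covering sieves to covering families in $L$ (so that there is a forgetful functor $U_{\mathcal{K}}:\mathbf{Frm}\to\mathcal{K}$). Then the functor $A:\mathcal{K}\to\mathbf{Frm}$ sending an object $\mathcal{C}$ to $\mathrm{Id}_{J_{\mathcal{C}}}(\mathcal{C})$ and an arrow $f:\mathcal{C}\to\mathcal{D}$ to the frame homomorphism $A(f):\mathrm{Id}_{J_{\mathcal{C}}}(\mathcal{C})\to\mathrm{Id}_{J_{\mathcal{D}}}(\mathcal{D})$ sending an ideal $I$ to the $J_{\mathcal{D}}$-ideal on $\mathcal{D}$ generated by $f(I)$ is left adjoint to the forgetful functor $U_{\mathcal{K}}:\mathbf{Frm}\to\mathcal{K}$.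
   Context: Posets are regarded as categories. $J$ is subcanonical if each $c$ is the supremum of every $J$-covering sieve on it. A $J$-ideal on $\mathcal{C}$ is a lower set $I$ such that whenever all elements of a $J$-covering sieve on $c$ lie in $I$, also $c\in I$; $\mathrm{Id}_J(\mathcal{C})$ is the frame of $J$-ideals ordered by inclusion. A morphism of sites $f:(\mathcal{C},J)\to(\mathcal{D},K)$ between posets is a monotone map such that: for every $d\in\mathcal{D}$ there is $c$ with $d\le f(c)$; whenever $d\le f(c),f(c')$ there is $c''\le c,c'$ with $d\le f(c'')$; and the image of each $J$-covering sieve generates a $K$-covering sieve. A map $f:\mathcal{C}\to L$ to a frame is filtering if it is monotone, $1_L=\bigvee_{c\in\mathcal{C}}f(c)$, and $f(c)\wedge f(c')=\bigvee\{f(b)\mid b\le c,\ b\le c'\}$ for all $c,c'\in\mathcal{C}$. It sends a covering sieve $S$ on $c$ to a covering family if $f(c)=\bigvee_{d\in S}f(d)$. $\mathbf{Frm}$ is the category of frames and frame homomorphisms. *)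

theory Defs
  imports "HOL-Algebra.Complete_Lattice" "HOL-Library.FuncSet" "HOL-Library.Nat_Bijection"
begin

section \<open>Categories, functors, adjunctions\<close>

text \<open>
  Categories are presented by hom-sets, which need not be disjoint. Therefore composition and the
  action of a functor on arrows take the objects in question as arguments: for \<open>f : X \<rightarrow> Y\<close> and
  \<open>g : Y \<rightarrow> Z\<close>, the composite \<open>g \<circ> f\<close> is \<open>cmp C X Y Z g f\<close>.
\<close>

record ('o, 'm) cat =
  obj :: "'o set"
  arr :: "'o \<Rightarrow> 'o \<Rightarrow> 'm set"
  idn :: "'o \<Rightarrow> 'm"
  cmp :: "'o \<Rightarrow> 'o \<Rightarrow> 'o \<Rightarrow> 'm \<Rightarrow> 'm \<Rightarrow> 'm"

locale category =
  fixes C :: "('o, 'm) cat"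
  assumes idn_arr: "X \<in> obj C \<Longrightarrow> idn C X \<in> arr C X X"
    and cmp_arr: "\<lbrakk>X \<in> obj C; Y \<in> obj C; Z \<in> obj C; f \<in> arr C X Y; g \<in> arr C Y Z\<rbrakk>
      \<Longrightarrow> cmp C X Y Z g f \<in> arr C X Z"
    and idn_right: "\<lbrakk>X \<in> obj C; Y \<in> obj C; f \<in> arr C X Y\<rbrakk> \<Longrightarrow> cmp C X X Y f (idn C X) = f"
    and idn_left: "\<lbrakk>X \<in> obj C; Y \<in> obj C; f \<in> arr C X Y\<rbrakk> \<Longrightarrow> cmp C X Y Y (idn C Y) f = f"
    and cmp_assoc: "\<lbrakk>W \<in> obj C; X \<in> obj C; Y \<in> obj C; Z \<in> obj C;
        f \<in> arr C W X; g \<in> arr C X Y; h \<in> arr C Y Z\<rbrakk>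
      \<Longrightarrow> cmp C W Y Z h (cmp C W X Y g f) = cmp C W X Z (cmp C X Y Z h g) f"

record ('o, 'm, 'p, 'n) fctr =
  on_obj :: "'o \<Rightarrow> 'p"
  on_arr :: "'o \<Rightarrow> 'o \<Rightarrow> 'm \<Rightarrow> 'n"

locale functor_between = dom: category A + cod: category B
  for A :: "('o, 'm) cat" and B :: "('p, 'n) cat" +
  fixes F :: "('o, 'm, 'p, 'n) fctr"
  assumes on_obj: "X \<in> obj A \<Longrightarrow> on_obj F X \<in> obj B"
    and on_arr: "\<lbrakk>X \<in> obj A; Y \<in> obj A; f \<in> arr A X Y\<rbrakk>
      \<Longrightarrow> on_arr F X Y f \<in> arr B (on_obj F X) (on_obj F Y)"
    and on_idn: "X \<in> obj A \<Longrightarrow> on_arr F X X (idn A X) = idn B (on_obj F X)"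
    and on_cmp: "\<lbrakk>X \<in> obj A; Y \<in> obj A; Z \<in> obj A; f \<in> arr A X Y; g \<in> arr A Y Z\<rbrakk>
      \<Longrightarrow> on_arr F X Z (cmp A X Y Z g f)
        = cmp B (on_obj F X) (on_obj F Y) (on_obj F Z) (on_arr F Y Z g) (on_arr F X Y f)"

text \<open>
  \<open>F : A \<rightarrow> B\<close> is left adjoint to \<open>G : B \<rightarrow> A\<close>: there are bijections
  \<open>\<phi> X Y : B(F X, Y) \<cong> A(X, G Y)\<close>, natural in \<open>X\<close> and \<open>Y\<close>.
\<close>

definition left_adjoint ::
  "('o, 'm) cat \<Rightarrow> ('p, 'n) cat \<Rightarrow> ('o, 'm, 'p, 'n) fctr \<Rightarrow> ('p, 'n, 'o, 'm) fctr \<Rightarrow> bool"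
  where "left_adjoint A B F G \<longleftrightarrow>
    functor_between A B F \<and> functor_between B A G \<and>
    (\<exists>\<phi> :: 'o \<Rightarrow> 'p \<Rightarrow> 'n \<Rightarrow> 'm.
      (\<forall>X \<in> obj A. \<forall>Y \<in> obj B. bij_betw (\<phi> X Y) (arr B (on_obj F X) Y) (arr A X (on_obj G Y))) \<and>
      (\<forall>X \<in> obj A. \<forall>X' \<in> obj A. \<forall>Y \<in> obj B. \<forall>Y' \<in> obj B.
        \<forall>f \<in> arr A X' X. \<forall>g \<in> arr B Y Y'. \<forall>h \<in> arr B (on_obj F X) Y.
          \<phi> X' Y' (cmp B (on_obj F X') Y Y' g
                    (cmp B (on_obj F X') (on_obj F X) Y h (on_arr F X' X f)))
          = cmp A X' (on_obj G Y) (on_obj G Y') (on_arr G Y Y' g)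
              (cmp A X' X (on_obj G Y) (\<phi> X Y h) f)))"


section \<open>Posets, frames, sites\<close>

text \<open>
  The relation of a \<open>gorder\<close> is defined on the whole type. Requiring it to hold inside the carrier
  only makes a poset determined by its carrier and its order on the carrier.
\<close>

definition poset :: "'a gorder \<Rightarrow> bool"
  where "poset P \<longleftrightarrow>
    partial_order P \<and> (\<forall>x y. x \<sqsubseteq>\<^bsub>P\<^esub> y \<longrightarrow> x \<in> carrier P \<and> y \<in> carrier P)"

definition frame :: "'a gorder \<Rightarrow> bool"
  where "frame L \<longleftrightarrow> poset L \<and> complete_lattice L \<and>
    (\<forall>x \<in> carrier L. \<forall>A. A \<subseteq> carrier L \<longrightarrow> x \<sqinter>\<^bsub>L\<^esub> (\<Squnion>\<^bsub>L\<^esub> A) = \<Squnion>\<^bsub>L\<^esub> ((\<lambda>a. x \<sqinter>\<^bsub>L\<^esub> a) ` A))"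

text \<open>Maps of posets are extensional functions, so that equality of arrows is equality of maps.\<close>

definition frame_homs :: "'a gorder \<Rightarrow> 'b gorder \<Rightarrow> ('a \<Rightarrow> 'b) set"
  where "frame_homs L M = {f \<in> carrier L \<rightarrow>\<^sub>E carrier M.
    f \<top>\<^bsub>L\<^esub> = \<top>\<^bsub>M\<^esub> \<and>
    (\<forall>x \<in> carrier L. \<forall>y \<in> carrier L. f (x \<sqinter>\<^bsub>L\<^esub> y) = f x \<sqinter>\<^bsub>M\<^esub> f y) \<and>
    (\<forall>A. A \<subseteq> carrier L \<longrightarrow> f (\<Squnion>\<^bsub>L\<^esub> A) = \<Squnion>\<^bsub>M\<^esub> (f ` A))}"

definition lower_set :: "'a gorder \<Rightarrow> 'a set \<Rightarrow> bool"
  where "lower_set P I \<longleftrightarrow>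
    I \<subseteq> carrier P \<and> (\<forall>x \<in> I. \<forall>y \<in> carrier P. y \<sqsubseteq>\<^bsub>P\<^esub> x \<longrightarrow> y \<in> I)"

definition principal :: "'a gorder \<Rightarrow> 'a \<Rightarrow> 'a set"
  where "principal P c = {d \<in> carrier P. d \<sqsubseteq>\<^bsub>P\<^esub> c}"

definition sieve_on :: "'a gorder \<Rightarrow> 'a \<Rightarrow> 'a set \<Rightarrow> bool"
  where "sieve_on P c S \<longleftrightarrow> lower_set P S \<and> S \<subseteq> principal P c"

text \<open>
  A sieve on \<open>c\<close> in a poset is a set of elements below \<open>c\<close>; its pullback along \<open>d \<le> c\<close> is its
  intersection with the principal lower set of \<open>d\<close>. \<open>J c\<close> is the set of covering sieves on \<open>c\<close>.
\<close>

definition grothendieck_topology :: "'a gorder \<Rightarrow> ('a \<Rightarrow> 'a set set) \<Rightarrow> bool"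
  where "grothendieck_topology P J \<longleftrightarrow>
    (\<forall>c \<in> carrier P.
      (\<forall>S \<in> J c. sieve_on P c S) \<and>
      principal P c \<in> J c \<and>
      (\<forall>S \<in> J c. \<forall>d \<in> principal P c. S \<inter> principal P d \<in> J d) \<and>
      (\<forall>S \<in> J c. \<forall>R. sieve_on P c R \<and> (\<forall>d \<in> S. R \<inter> principal P d \<in> J d) \<longrightarrow> R \<in> J c))"

definition subcanonical :: "'a gorder \<Rightarrow> ('a \<Rightarrow> 'a set set) \<Rightarrow> bool"
  where "subcanonical P J \<longleftrightarrow> (\<forall>c \<in> carrier P. \<forall>S \<in> J c. is_lub P c S)"

definition site_morphisms ::
  "'a gorder \<Rightarrow> ('a \<Rightarrow> 'a set set) \<Rightarrow> 'b gorder \<Rightarrow> ('b \<Rightarrow> 'b set set) \<Rightarrow> ('a \<Rightarrow> 'b) set"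
  where "site_morphisms C J D K = {f \<in> carrier C \<rightarrow>\<^sub>E carrier D.
    isotone C D f \<and>
    (\<forall>d \<in> carrier D. \<exists>c \<in> carrier C. d \<sqsubseteq>\<^bsub>D\<^esub> f c) \<and>
    (\<forall>d \<in> carrier D. \<forall>c \<in> carrier C. \<forall>c' \<in> carrier C. d \<sqsubseteq>\<^bsub>D\<^esub> f c \<and> d \<sqsubseteq>\<^bsub>D\<^esub> f c' \<longrightarrow>
      (\<exists>c'' \<in> carrier C. c'' \<sqsubseteq>\<^bsub>C\<^esub> c \<and> c'' \<sqsubseteq>\<^bsub>C\<^esub> c' \<and> d \<sqsubseteq>\<^bsub>D\<^esub> f c'')) \<and>
    (\<forall>c \<in> carrier C. \<forall>S \<in> J c. {d \<in> carrier D. \<exists>s \<in> S. d \<sqsubseteq>\<^bsub>D\<^esub> f s} \<in> K (f c))}"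

definition filtering :: "'a gorder \<Rightarrow> 'b gorder \<Rightarrow> ('a \<Rightarrow> 'b) \<Rightarrow> bool"
  where "filtering C L f \<longleftrightarrow>
    isotone C L f \<and>
    \<top>\<^bsub>L\<^esub> = \<Squnion>\<^bsub>L\<^esub> (f ` carrier C) \<and>
    (\<forall>c \<in> carrier C. \<forall>c' \<in> carrier C.
      f c \<sqinter>\<^bsub>L\<^esub> f c' = \<Squnion>\<^bsub>L\<^esub> {f b | b. b \<in> carrier C \<and> b \<sqsubseteq>\<^bsub>C\<^esub> c \<and> b \<sqsubseteq>\<^bsub>C\<^esub> c'})"

definition sends_covers_to_covers ::
  "'a gorder \<Rightarrow> ('a \<Rightarrow> 'a set set) \<Rightarrow> 'b gorder \<Rightarrow> ('a \<Rightarrow> 'b) \<Rightarrow> bool"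
  where "sends_covers_to_covers C J L f \<longleftrightarrow>
    (\<forall>c \<in> carrier C. \<forall>S \<in> J c. f c = \<Squnion>\<^bsub>L\<^esub> (f ` S))"


section \<open>The frame of ideals\<close>

definition is_ideal :: "'a gorder \<Rightarrow> ('a \<Rightarrow> 'a set set) \<Rightarrow> 'a set \<Rightarrow> bool"
  where "is_ideal P J I \<longleftrightarrow>
    lower_set P I \<and> (\<forall>c \<in> carrier P. \<forall>S \<in> J c. S \<subseteq> I \<longrightarrow> c \<in> I)"

definition generated_ideal :: "'a gorder \<Rightarrow> ('a \<Rightarrow> 'a set set) \<Rightarrow> 'a set \<Rightarrow> 'a set"
  where "generated_ideal P J X = \<Inter> {I. is_ideal P J I \<and> X \<subseteq> I}"

definition Id_frame :: "'a gorder \<Rightarrow> ('a \<Rightarrow> 'a set set) \<Rightarrow> 'a set gorder"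
  where "Id_frame P J =
    \<lparr>carrier = {I. is_ideal P J I}, eq = (=),
     le = (\<lambda>I I'. is_ideal P J I \<and> is_ideal P J I' \<and> I \<subseteq> I')\<rparr>"

definition Id_map ::
  "'a gorder \<Rightarrow> ('a \<Rightarrow> 'a set set) \<Rightarrow> 'b gorder \<Rightarrow> ('b \<Rightarrow> 'b set set) \<Rightarrow> ('a \<Rightarrow> 'b) \<Rightarrow> 'a set \<Rightarrow> 'b set"
  where "Id_map C J D K f = (\<lambda>I \<in> carrier (Id_frame C J). generated_ideal D K (f ` I))"


section \<open>The categories and functors\<close>

text \<open>
  The ideals of a poset on the type \<open>'a\<close> live on \<open>'a set\<close>, whereas the frame of ideals has to be an
  object of the same category of frames that is contained in \<open>K\<close>. So, as usual, posets and frames are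
  taken relative to a universe of small sets. Here this is a family of sets of elements of \<open>'a\<close>,
  closed under subsets and under powersets, where \<open>code\<close> represents the subsets of a small set as
  elements of \<open>'a\<close>. Any type modelling the elements of a Grothendieck universe provides an instance.
\<close>

definition universe :: "('a set \<Rightarrow> bool) \<Rightarrow> ('a set \<Rightarrow> 'a) \<Rightarrow> bool"
  where "universe small code \<longleftrightarrow>
    (\<forall>X Y. small X \<and> Y \<subseteq> X \<longrightarrow> small Y) \<and>
    (\<forall>X. small X \<longrightarrow> inj_on code (Pow X) \<and> small (code ` Pow X))"

text \<open>The hereditarily finite sets, in the Ackermann encoding.\<close>

lemma universe_finite: "universe finite set_encode"
  unfolding universe_def
  by (auto intro: finite_subset inj_on_subset[OF inj_on_set_encode])

definition transport :: "('a \<Rightarrow> 'b) \<Rightarrow> 'a gorder \<Rightarrow> 'b gorder"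
  where "transport e P =
    \<lparr>carrier = e ` carrier P, eq = (=),
     le = (\<lambda>x y. \<exists>a \<in> carrier P. \<exists>b \<in> carrier P. x = e a \<and> y = e b \<and> a \<sqsubseteq>\<^bsub>P\<^esub> b)\<rparr>"

definition transport_map :: "('a \<Rightarrow> 'b) \<Rightarrow> 'a gorder \<Rightarrow> ('c \<Rightarrow> 'd) \<Rightarrow> ('a \<Rightarrow> 'c) \<Rightarrow> 'b \<Rightarrow> 'd"
  where "transport_map e P e' h = (\<lambda>x \<in> e ` carrier P. e' (h (inv_into (carrier P) e x)))"

definition poset_cat ::
  "'a gorder set \<Rightarrow> ('a gorder \<Rightarrow> 'a gorder \<Rightarrow> ('a \<Rightarrow> 'a) set) \<Rightarrow> ('a gorder, 'a \<Rightarrow> 'a) cat"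
  where "poset_cat Ob H =
    \<lparr>obj = Ob, arr = H, idn = (\<lambda>C. restrict id (carrier C)),
     cmp = (\<lambda>C D E g f. compose (carrier C) g f)\<rparr>"

definition Frm :: "('a set \<Rightarrow> bool) \<Rightarrow> ('a gorder, 'a \<Rightarrow> 'a) cat"
  where "Frm small = poset_cat {L. frame L \<and> small (carrier L)} frame_homs"

definition forgetful :: "('a gorder, 'a \<Rightarrow> 'a, 'a gorder, 'a \<Rightarrow> 'a) fctr"
  where "forgetful = \<lparr>on_obj = (\<lambda>L. L), on_arr = (\<lambda>L M f. f)\<rparr>"

definition Id_functor ::
  "('a set \<Rightarrow> 'a) \<Rightarrow> ('a gorder \<Rightarrow> 'a \<Rightarrow> 'a set set)
    \<Rightarrow> ('a gorder, 'a \<Rightarrow> 'a, 'a gorder, 'a \<Rightarrow> 'a) fctr"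
  where "Id_functor code J =
    \<lparr>on_obj = (\<lambda>C. transport code (Id_frame C (J C))),
     on_arr = (\<lambda>C D f. transport_map code (Id_frame C (J C)) code (Id_map C (J C) D (J D) f))\<rparr>"

end

theory Submission
  imports Defs
begin

text \<open>
  For a poset \<open>C\<close> with a subcanonical topology \<open>J\<close>, every principal lower set \<open>\<down>c\<close> is a \<open>J\<close>-ideal, and
  the map \<open>c \<mapsto> \<down>c\<close> into the frame of ideals is universal among the filtering maps from \<open>C\<close> to frames
  that send covering sieves to covering families. Uniqueness holds because each ideal \<open>I\<close> is the
  supremum of the \<open>\<down>c\<close> with \<open>c \<in> I\<close> (\<open>frame_homs_eq_on_principals\<close>). For existence, \<open>f : C \<rightarrow> L\<close> is
  extended by \<open>I \<mapsto> \<Squnion> f(I)\<close>. Preservation of covers makes \<open>{c. f c \<le> u}\<close> an ideal for each \<open>u\<close>, so passing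
  from a set to the ideal it generates does not change the supremum of its image, and the extension
  preserves suprema; the two filtering conditions and the infinite distributive law of \<open>L\<close> give the
  top element and binary meets (\<open>ideal_extension_frame_hom\<close>). As the arrows from \<open>C\<close> to a frame are
  exactly these maps, restriction along \<open>c \<mapsto> \<down>c\<close> is the bijection of the adjunction
  (\<open>bij_betw_restrict_principal\<close>).

  The rest is drawn from the universal property. A morphism of sites \<open>f : C \<rightarrow> D\<close> makes \<open>c \<mapsto> \<down>f(c)\<close>
  filtering and cover preserving (\<open>principal_site_morphism\<close>), and the extension of this map sends \<open>I\<close>
  to the ideal generated by \<open>f(I)\<close>; so \<open>A(f)\<close> is a frame homomorphism, and the only one with
  \<open>A(f)(\<down>c) = \<down>f(c)\<close>. Functoriality of \<open>A\<close> and naturality of the bijection then need checking on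
  principal ideals alone. Replacing ideals by their codes is harmless, because an order isomorphism
  carries the whole frame structure with it (\<open>order_iso_frame\<close>).
\<close>


section \<open>Posets and frames\<close>

lemma posetI:
  assumes "eq P = (=)"
    and "\<And>x. x \<in> carrier P \<Longrightarrow> x \<sqsubseteq>\<^bsub>P\<^esub> x"
    and "\<And>x y. x \<sqsubseteq>\<^bsub>P\<^esub> y \<Longrightarrow> y \<sqsubseteq>\<^bsub>P\<^esub> x \<Longrightarrow> x = y"
    and "\<And>x y z. x \<sqsubseteq>\<^bsub>P\<^esub> y \<Longrightarrow> y \<sqsubseteq>\<^bsub>P\<^esub> z \<Longrightarrow> x \<sqsubseteq>\<^bsub>P\<^esub> z"
    and "\<And>x y. x \<sqsubseteq>\<^bsub>P\<^esub> y \<Longrightarrow> x \<in> carrier P \<and> y \<in> carrier P"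
  shows "poset P"
proof -
  have "partial_order P"
    by unfold_locales (use assms(2-4) in \<open>auto simp only: assms(1)\<close>)
  then show ?thesis
    using assms(5) unfolding poset_def by blast
qed

lemma poset_refl: "poset P \<Longrightarrow> x \<in> carrier P \<Longrightarrow> x \<sqsubseteq>\<^bsub>P\<^esub> x"
  unfolding poset_def partial_order_def weak_partial_order_def weak_partial_order_axioms_def by blast

lemma poset_le_closed: "poset P \<Longrightarrow> x \<sqsubseteq>\<^bsub>P\<^esub> y \<Longrightarrow> x \<in> carrier P \<and> y \<in> carrier P"
  unfolding poset_def by blast

lemma poset_antisym: "poset P \<Longrightarrow> x \<sqsubseteq>\<^bsub>P\<^esub> y \<Longrightarrow> y \<sqsubseteq>\<^bsub>P\<^esub> x \<Longrightarrow> x = y"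
  unfolding poset_def using partial_order.le_antisym by metis

lemma poset_trans: "poset P \<Longrightarrow> x \<sqsubseteq>\<^bsub>P\<^esub> y \<Longrightarrow> y \<sqsubseteq>\<^bsub>P\<^esub> z \<Longrightarrow> x \<sqsubseteq>\<^bsub>P\<^esub> z"
  unfolding poset_def partial_order_def by (meson weak_partial_order.le_trans)

lemma poset_weak: "poset P \<Longrightarrow> weak_partial_order P"
  unfolding poset_def partial_order_def by blast

lemma is_lub_iff:
  assumes "A \<subseteq> carrier P"
  shows "is_lub P s A \<longleftrightarrow> s \<in> carrier P \<and> (\<forall>a \<in> A. a \<sqsubseteq>\<^bsub>P\<^esub> s) \<and>
    (\<forall>u \<in> carrier P. (\<forall>a \<in> A. a \<sqsubseteq>\<^bsub>P\<^esub> u) \<longrightarrow> s \<sqsubseteq>\<^bsub>P\<^esub> u)"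
  using assms unfolding least_def Upper_def by blast

lemma poset_is_lub_Sup: "poset P \<Longrightarrow> is_lub P s A \<Longrightarrow> \<Squnion>\<^bsub>P\<^esub> A = s"
  unfolding sup_def poset_def by (metis partial_order.least_unique someI_ex)

lemma poset_Sup_eqI:
  assumes P: "poset P" and A: "A \<subseteq> carrier P" and s: "s \<in> carrier P"
    and ub: "\<And>a. a \<in> A \<Longrightarrow> a \<sqsubseteq>\<^bsub>P\<^esub> s"
    and least: "\<And>u. u \<in> carrier P \<Longrightarrow> (\<And>a. a \<in> A \<Longrightarrow> a \<sqsubseteq>\<^bsub>P\<^esub> u) \<Longrightarrow> s \<sqsubseteq>\<^bsub>P\<^esub> u"
  shows "\<Squnion>\<^bsub>P\<^esub> A = s"
  using assms by (intro poset_is_lub_Sup) (simp_all add: is_lub_iff)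

lemma poset_meet_eqI:
  assumes P: "poset P" and "x \<in> carrier P" "y \<in> carrier P"
    and "m \<sqsubseteq>\<^bsub>P\<^esub> x" "m \<sqsubseteq>\<^bsub>P\<^esub> y"
    and "\<And>u. u \<sqsubseteq>\<^bsub>P\<^esub> x \<Longrightarrow> u \<sqsubseteq>\<^bsub>P\<^esub> y \<Longrightarrow> u \<sqsubseteq>\<^bsub>P\<^esub> m"
  shows "x \<sqinter>\<^bsub>P\<^esub> y = m"
proof -
  have "is_glb P m {x, y}"
    using assms poset_le_closed[OF P] unfolding greatest_def Lower_def by blast
  moreover have "partial_order P"
    using P by (simp add: poset_def)
  ultimately show ?thesis
    unfolding meet_def inf_def by (metis partial_order.greatest_unique someI_ex)
qed

lemma poset_top_eqI:
  assumes P: "poset P" and "t \<in> carrier P" "\<And>x. x \<in> carrier P \<Longrightarrow> x \<sqsubseteq>\<^bsub>P\<^esub> t"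
  shows "\<top>\<^bsub>P\<^esub> = t"
proof -
  have "greatest P t (carrier P)"
    using assms unfolding greatest_def by blast
  moreover have "partial_order P"
    using P by (simp add: poset_def)
  ultimately show ?thesis
    unfolding top_def by (metis partial_order.greatest_unique someI_ex)
qed

lemma poset_complete_latticeI:
  assumes P: "poset P" and lub: "\<And>A. A \<subseteq> carrier P \<Longrightarrow> \<exists>s. is_lub P s A"
  shows "complete_lattice P"
proof -
  interpret partial_order P
    using P by (simp add: poset_def)
  show ?thesis
  proof (rule complete_latticeI)
    fix A assume A: "A \<subseteq> carrier P"
    show "\<exists>s. is_lub P s A"
      by (rule lub[OF A])
    \<comment> \<open>The infimum is the supremum of the lower bounds.\<close>
    obtain i where i: "is_lub P i (Lower P A)"
      using lub[of "Lower P A"] by auto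
    then have "is_glb P i A"
      using A unfolding greatest_def least_def Lower_def Upper_def by blast
    then show "\<exists>i. is_glb P i A" ..
  qed
qed

lemma frame_poset: "frame L \<Longrightarrow> poset L"
  by (simp add: frame_def)

lemma frame_complete: "frame L \<Longrightarrow> complete_lattice L"
  by (simp add: frame_def)

lemma frame_Sup_closed: "frame L \<Longrightarrow> A \<subseteq> carrier L \<Longrightarrow> \<Squnion>\<^bsub>L\<^esub> A \<in> carrier L"
proof -
  assume "frame L" "A \<subseteq> carrier L"
  then interpret complete_lattice L by (simp add: frame_complete)
  show ?thesis using \<open>A \<subseteq> carrier L\<close> by simp
qed

lemma frame_le_Sup: "frame L \<Longrightarrow> A \<subseteq> carrier L \<Longrightarrow> a \<in> A \<Longrightarrow> a \<sqsubseteq>\<^bsub>L\<^esub> \<Squnion>\<^bsub>L\<^esub> A"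
proof -
  assume L: "frame L" "A \<subseteq> carrier L" "a \<in> A"
  then interpret complete_lattice L by (simp add: frame_complete)
  show ?thesis using L by (simp add: sup_upper)
qed

lemma frame_Sup_le:
  "frame L \<Longrightarrow> A \<subseteq> carrier L \<Longrightarrow> u \<in> carrier L \<Longrightarrow> (\<And>a. a \<in> A \<Longrightarrow> a \<sqsubseteq>\<^bsub>L\<^esub> u) \<Longrightarrow> \<Squnion>\<^bsub>L\<^esub> A \<sqsubseteq>\<^bsub>L\<^esub> u"
proof -
  assume L: "frame L" "A \<subseteq> carrier L" "u \<in> carrier L" "\<And>a. a \<in> A \<Longrightarrow> a \<sqsubseteq>\<^bsub>L\<^esub> u"
  then interpret complete_lattice L by (simp add: frame_complete)
  show ?thesis using L by (simp add: sup_least)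
qed

lemma frame_top: "frame L \<Longrightarrow> \<top>\<^bsub>L\<^esub> \<in> carrier L \<and> (\<forall>x \<in> carrier L. x \<sqsubseteq>\<^bsub>L\<^esub> \<top>\<^bsub>L\<^esub>)"
proof -
  assume "frame L"
  then interpret complete_lattice L by (simp add: frame_complete)
  show ?thesis by simp
qed

lemma frame_meet:
  "frame L \<Longrightarrow> x \<in> carrier L \<Longrightarrow> y \<in> carrier L \<Longrightarrow>
    x \<sqinter>\<^bsub>L\<^esub> y \<in> carrier L \<and> x \<sqinter>\<^bsub>L\<^esub> y \<sqsubseteq>\<^bsub>L\<^esub> x \<and> x \<sqinter>\<^bsub>L\<^esub> y \<sqsubseteq>\<^bsub>L\<^esub> y \<and>
    (\<forall>u. u \<sqsubseteq>\<^bsub>L\<^esub> x \<and> u \<sqsubseteq>\<^bsub>L\<^esub> y \<longrightarrow> u \<sqsubseteq>\<^bsub>L\<^esub> x \<sqinter>\<^bsub>L\<^esub> y)"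
proof -
  assume L: "frame L" "x \<in> carrier L" "y \<in> carrier L"
  then interpret complete_lattice L by (simp add: frame_complete)
  show ?thesis
    using L meet_le poset_le_closed[OF frame_poset[OF L(1)]] by (simp add: meet_left meet_right)
qed

lemma frame_le_iff_meet:
  "frame L \<Longrightarrow> x \<in> carrier L \<Longrightarrow> y \<in> carrier L \<Longrightarrow> x \<sqsubseteq>\<^bsub>L\<^esub> y \<longleftrightarrow> x \<sqinter>\<^bsub>L\<^esub> y = x"
  by (metis frame_meet frame_poset poset_meet_eqI poset_refl)

lemma frame_meet_Sup_le:
  assumes L: "frame L" and A: "A \<subseteq> carrier L" and x: "x \<in> carrier L" and u: "u \<in> carrier L"
    and le: "\<And>a. a \<in> A \<Longrightarrow> x \<sqinter>\<^bsub>L\<^esub> a \<sqsubseteq>\<^bsub>L\<^esub> u"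
  shows "x \<sqinter>\<^bsub>L\<^esub> \<Squnion>\<^bsub>L\<^esub> A \<sqsubseteq>\<^bsub>L\<^esub> u"
proof -
  have "x \<sqinter>\<^bsub>L\<^esub> \<Squnion>\<^bsub>L\<^esub> A = \<Squnion>\<^bsub>L\<^esub> ((\<lambda>a. x \<sqinter>\<^bsub>L\<^esub> a) ` A)"
    using L A x unfolding frame_def by blast
  moreover have "(\<lambda>a. x \<sqinter>\<^bsub>L\<^esub> a) ` A \<subseteq> carrier L"
    using A frame_meet[OF L x] by blast
  ultimately show ?thesis
    using frame_Sup_le[OF L _ u] le by auto
qed

text \<open>
  Only one inequality of the infinite distributive law needs checking, and it can be stated without
  computing meets.
\<close>

lemma frameI:
  assumes P: "poset P" and lub: "\<And>A. A \<subseteq> carrier P \<Longrightarrow> \<exists>s. is_lub P s A"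
    and distrib: "\<And>A s x y u. \<lbrakk>A \<subseteq> carrier P; is_lub P s A; y \<sqsubseteq>\<^bsub>P\<^esub> x; y \<sqsubseteq>\<^bsub>P\<^esub> s; u \<in> carrier P;
      \<And>a w. \<lbrakk>a \<in> A; w \<sqsubseteq>\<^bsub>P\<^esub> x; w \<sqsubseteq>\<^bsub>P\<^esub> a\<rbrakk> \<Longrightarrow> w \<sqsubseteq>\<^bsub>P\<^esub> u\<rbrakk> \<Longrightarrow> y \<sqsubseteq>\<^bsub>P\<^esub> u"
  shows "frame P"
proof -
  interpret complete_lattice P
    by (rule poset_complete_latticeI[OF P lub])
  have "x \<sqinter>\<^bsub>P\<^esub> \<Squnion>\<^bsub>P\<^esub> A = \<Squnion>\<^bsub>P\<^esub> ((\<lambda>a. x \<sqinter>\<^bsub>P\<^esub> a) ` A)" if x: "x \<in> carrier P" and A: "A \<subseteq> carrier P" for x A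
  proof (rule HOL.sym, rule poset_Sup_eqI[OF P])
    show "(\<lambda>a. x \<sqinter>\<^bsub>P\<^esub> a) ` A \<subseteq> carrier P" "x \<sqinter>\<^bsub>P\<^esub> \<Squnion>\<^bsub>P\<^esub> A \<in> carrier P"
      using x A by auto
    show "b \<sqsubseteq>\<^bsub>P\<^esub> x \<sqinter>\<^bsub>P\<^esub> \<Squnion>\<^bsub>P\<^esub> A" if b: "b \<in> (\<lambda>a. x \<sqinter>\<^bsub>P\<^esub> a) ` A" for b
    proof -
      obtain a where a: "a \<in> A" "b = x \<sqinter>\<^bsub>P\<^esub> a"
        using b by blast
      have "x \<sqinter>\<^bsub>P\<^esub> a \<sqsubseteq>\<^bsub>P\<^esub> \<Squnion>\<^bsub>P\<^esub> A"
        using x A a meet_right[of x a] sup_upper[OF A a(1)] poset_trans[OF P] by blast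
      then show ?thesis
        using x A a by (intro meet_le) (auto simp: meet_left)
    qed
    fix u assume u: "u \<in> carrier P" "\<And>b. b \<in> (\<lambda>a. x \<sqinter>\<^bsub>P\<^esub> a) ` A \<Longrightarrow> b \<sqsubseteq>\<^bsub>P\<^esub> u"
    show "x \<sqinter>\<^bsub>P\<^esub> \<Squnion>\<^bsub>P\<^esub> A \<sqsubseteq>\<^bsub>P\<^esub> u"
    proof (rule distrib[OF A, of "\<Squnion>\<^bsub>P\<^esub> A" _ x])
      show "is_lub P (\<Squnion>\<^bsub>P\<^esub> A) A"
        by (rule sup_lub[OF A])
      fix a w assume w: "a \<in> A" "w \<sqsubseteq>\<^bsub>P\<^esub> x" "w \<sqsubseteq>\<^bsub>P\<^esub> a"
      then have "w \<sqsubseteq>\<^bsub>P\<^esub> x \<sqinter>\<^bsub>P\<^esub> a"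
        using poset_le_closed[OF P] by (intro meet_le) auto
      then show "w \<sqsubseteq>\<^bsub>P\<^esub> u"
        using u(2) w(1) poset_trans[OF P] by blast
    qed (use x A u in \<open>auto simp: meet_left meet_right\<close>)
  qed
  then show ?thesis
    using P complete_lattice_axioms by (simp add: frame_def)
qed


section \<open>Frame homomorphisms\<close>

lemma frame_hom_closed: "f \<in> frame_homs L M \<Longrightarrow> x \<in> carrier L \<Longrightarrow> f x \<in> carrier M"
  unfolding frame_homs_def by blast

lemma frame_hom_extensional: "f \<in> frame_homs L M \<Longrightarrow> f \<in> extensional (carrier L)"
  unfolding frame_homs_def by (auto simp: PiE_def)

lemma frame_hom_top: "f \<in> frame_homs L M \<Longrightarrow> f \<top>\<^bsub>L\<^esub> = \<top>\<^bsub>M\<^esub>"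
  unfolding frame_homs_def by blast

lemma frame_hom_meet:
  "f \<in> frame_homs L M \<Longrightarrow> x \<in> carrier L \<Longrightarrow> y \<in> carrier L \<Longrightarrow> f (x \<sqinter>\<^bsub>L\<^esub> y) = f x \<sqinter>\<^bsub>M\<^esub> f y"
  unfolding frame_homs_def by blast

lemma frame_hom_Sup: "f \<in> frame_homs L M \<Longrightarrow> A \<subseteq> carrier L \<Longrightarrow> f (\<Squnion>\<^bsub>L\<^esub> A) = \<Squnion>\<^bsub>M\<^esub> (f ` A)"
  unfolding frame_homs_def by blast

lemma frame_hom_mono:
  assumes "frame L" "frame M" "f \<in> frame_homs L M" "x \<sqsubseteq>\<^bsub>L\<^esub> y"
  shows "f x \<sqsubseteq>\<^bsub>M\<^esub> f y"
proof -
  have xy: "x \<in> carrier L" "y \<in> carrier L"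
    using poset_le_closed[OF frame_poset[OF assms(1)] assms(4)] by blast+
  then have "f x \<sqinter>\<^bsub>M\<^esub> f y = f x"
    using assms(4) frame_le_iff_meet[OF assms(1)] frame_hom_meet[OF assms(3)] by metis
  then show ?thesis
    using frame_le_iff_meet[OF assms(2)] frame_hom_closed[OF assms(3)] xy by simp
qed

lemma frame_hom_id: "frame L \<Longrightarrow> restrict id (carrier L) \<in> frame_homs L L"
proof -
  assume L: "frame L"
  have "restrict id (carrier L) ` A = A" if "A \<subseteq> carrier L" for A
    using that by (auto simp: image_def)
  then show ?thesis
    using frame_top[OF L] frame_meet[OF L] frame_Sup_closed[OF L]
    unfolding frame_homs_def by (simp add: subset_eq)
qed

lemma frame_hom_compose:
  assumes L: "frame L" and f: "f \<in> frame_homs L M" and g: "g \<in> frame_homs M N"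
  shows "compose (carrier L) g f \<in> frame_homs L N"
proof -
  have im: "compose (carrier L) g f ` A = g ` f ` A" if "A \<subseteq> carrier L" for A
    using that by (force simp: compose_def image_image)
  have fA: "f ` A \<subseteq> carrier M" if "A \<subseteq> carrier L" for A
    using that frame_hom_closed[OF f] by blast
  show ?thesis
    unfolding frame_homs_def
  proof (intro CollectI conjI ballI allI impI)
    show "compose (carrier L) g f \<in> carrier L \<rightarrow>\<^sub>E carrier N"
      using frame_hom_closed[OF f] frame_hom_closed[OF g] by (auto simp: compose_def)
  qed (use frame_top[OF L] frame_meet[OF L] frame_Sup_closed[OF L] fA im in
      \<open>simp_all add: compose_eq frame_hom_top[OF f] frame_hom_top[OF g] frame_hom_meet[OF f]
        frame_hom_meet[OF g] frame_hom_Sup[OF f] frame_hom_Sup[OF g] frame_hom_closed[OF f]\<close>)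
qed

lemma poset_cat_simps [simp]:
  "obj (poset_cat Ob H) = Ob"
  "arr (poset_cat Ob H) = H"
  "idn (poset_cat Ob H) C = restrict id (carrier C)"
  "cmp (poset_cat Ob H) C D E g f = compose (carrier C) g f"
  by (simp_all add: poset_cat_def)

lemma category_Frm: "category (Frm small)"
  unfolding Frm_def
proof (unfold_locales, simp_all)
  fix L M N and f g :: "'a \<Rightarrow> 'a"
  assume "frame L \<and> small (carrier L)" "f \<in> frame_homs L M" "g \<in> frame_homs M N"
  then show "compose (carrier L) g f \<in> frame_homs L N"
    using frame_hom_compose by blast
next
  fix L M and f :: "'a \<Rightarrow> 'a"
  assume f: "f \<in> frame_homs L M"
  show "compose (carrier L) f (restrict id (carrier L)) = f"
    by (rule extensionalityI[OF compose_extensional frame_hom_extensional[OF f]])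
      (simp add: compose_eq)
  show "compose (carrier L) (restrict id (carrier M)) f = f"
    by (rule extensionalityI[OF compose_extensional frame_hom_extensional[OF f]])
      (simp add: compose_eq frame_hom_closed[OF f])
next
  fix K L M N and f g h :: "'a \<Rightarrow> 'a"
  assume "f \<in> frame_homs K L"
  then show "compose (carrier K) h (compose (carrier K) g f) = compose (carrier K) (compose (carrier L) h g) f"
    by (intro extensionalityI[OF compose_extensional compose_extensional])
      (simp add: compose_eq frame_hom_closed)
qed (simp add: frame_hom_id)

section \<open>The frame of ideals of a site\<close>

locale site =
  fixes C :: "'a gorder" and J :: "'a \<Rightarrow> 'a set set"
  assumes is_poset: "poset C" and topology: "grothendieck_topology C J"
begin

lemma cover_sieve:
  assumes "c \<in> carrier C" "S \<in> J c"
  shows "S \<subseteq> carrier C" "s \<in> S \<Longrightarrow> s \<sqsubseteq>\<^bsub>C\<^esub> c" "s \<in> S \<Longrightarrow> d \<sqsubseteq>\<^bsub>C\<^esub> s \<Longrightarrow> d \<in> S"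
proof -
  have S: "sieve_on C c S"
    using topology assms unfolding grothendieck_topology_def by blast
  then show "S \<subseteq> carrier C" "s \<in> S \<Longrightarrow> s \<sqsubseteq>\<^bsub>C\<^esub> c"
    unfolding sieve_on_def principal_def by blast+
  show "d \<in> S" if "s \<in> S" "d \<sqsubseteq>\<^bsub>C\<^esub> s"
    using S that poset_le_closed[OF is_poset that(2)] unfolding sieve_on_def lower_set_def by blast
qed

lemma cover_pullback:
  assumes "c \<in> carrier C" "S \<in> J c" "d \<sqsubseteq>\<^bsub>C\<^esub> c"
  shows "S \<inter> principal C d \<in> J d"
  using topology assms poset_le_closed[OF is_poset assms(3)]
  unfolding grothendieck_topology_def principal_def by blast

lemma principal_self: "c \<in> carrier C \<Longrightarrow> c \<in> principal C c"
  using poset_refl[OF is_poset] by (simp add: principal_def)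

lemma idealI:
  assumes "I \<subseteq> carrier C"
    and "\<And>x y. x \<in> I \<Longrightarrow> y \<sqsubseteq>\<^bsub>C\<^esub> x \<Longrightarrow> y \<in> I"
    and "\<And>c S. c \<in> carrier C \<Longrightarrow> S \<in> J c \<Longrightarrow> S \<subseteq> I \<Longrightarrow> c \<in> I"
  shows "is_ideal C J I"
  using assms unfolding is_ideal_def lower_set_def by blast

lemma ideal_subset: "is_ideal C J I \<Longrightarrow> I \<subseteq> carrier C"
  unfolding is_ideal_def lower_set_def by blast

lemma ideal_lower: "is_ideal C J I \<Longrightarrow> x \<in> I \<Longrightarrow> y \<sqsubseteq>\<^bsub>C\<^esub> x \<Longrightarrow> y \<in> I"
  using poset_le_closed[OF is_poset] unfolding is_ideal_def lower_set_def by blast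

lemma ideal_cover: "is_ideal C J I \<Longrightarrow> c \<in> carrier C \<Longrightarrow> S \<in> J c \<Longrightarrow> S \<subseteq> I \<Longrightarrow> c \<in> I"
  unfolding is_ideal_def by blast

lemma ideal_carrier: "is_ideal C J (carrier C)"
  using poset_le_closed[OF is_poset] by (intro idealI) auto

lemma ideal_Int: "is_ideal C J I \<Longrightarrow> is_ideal C J I' \<Longrightarrow> is_ideal C J (I \<inter> I')"
  by (rule idealI) (auto dest: ideal_subset ideal_lower ideal_cover)

lemma generated_ideal_least: "is_ideal C J I \<Longrightarrow> X \<subseteq> I \<Longrightarrow> generated_ideal C J X \<subseteq> I"
  unfolding generated_ideal_def by blast

lemma generated_ideal_superset: "X \<subseteq> generated_ideal C J X"
  unfolding generated_ideal_def by blast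

lemma generated_ideal_is_ideal:
  assumes "X \<subseteq> carrier C"
  shows "is_ideal C J (generated_ideal C J X)"
proof (rule idealI)
  show "generated_ideal C J X \<subseteq> carrier C"
    by (rule generated_ideal_least[OF ideal_carrier assms])
  show "y \<in> generated_ideal C J X" if "x \<in> generated_ideal C J X" "y \<sqsubseteq>\<^bsub>C\<^esub> x" for x y
    using that ideal_lower unfolding generated_ideal_def by blast
  show "c \<in> generated_ideal C J X"
    if "c \<in> carrier C" "S \<in> J c" "S \<subseteq> generated_ideal C J X" for c S
    unfolding generated_ideal_def
    using that ideal_cover[OF _ that(1,2)] generated_ideal_least[of _ X] by blast
qed

text \<open>
  This is the Heyting implication of \<open>I\<close> and \<open>I'\<close>, which yields the infinite distributive law. That it
  is an ideal rests on the stability of covering sieves under pullback: to see that an element \<open>e\<close> of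
  \<open>\<down>c \<inter> I\<close> lies in \<open>I'\<close>, a covering sieve on \<open>c\<close> is pulled back to one on \<open>e\<close>.
\<close>

lemma ideal_implication:
  assumes I: "is_ideal C J I" and I': "is_ideal C J I'"
  shows "is_ideal C J {c \<in> carrier C. principal C c \<inter> I \<subseteq> I'}"
proof (rule idealI)
  show "y \<in> {c \<in> carrier C. principal C c \<inter> I \<subseteq> I'}"
    if "x \<in> {c \<in> carrier C. principal C c \<inter> I \<subseteq> I'}" "y \<sqsubseteq>\<^bsub>C\<^esub> x" for x y
    using that poset_le_closed[OF is_poset] poset_trans[OF is_poset] unfolding principal_def by blast
next
  fix c S assume c: "c \<in> carrier C" and S: "S \<in> J c"
    and sub: "S \<subseteq> {c \<in> carrier C. principal C c \<inter> I \<subseteq> I'}"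
  have "e \<in> I'" if e: "e \<in> I" "e \<sqsubseteq>\<^bsub>C\<^esub> c" for e
  proof (rule ideal_cover[OF I' _ cover_pullback[OF c S e(2)]])
    show "e \<in> carrier C"
      using poset_le_closed[OF is_poset e(2)] by blast
    show "S \<inter> principal C e \<subseteq> I'"
    proof
      fix s assume s: "s \<in> S \<inter> principal C e"
      then have "s \<in> I" "s \<in> principal C s"
        using ideal_lower[OF I e(1)] poset_refl[OF is_poset] unfolding principal_def by auto
      then show "s \<in> I'"
        using s sub by blast
    qed
  qed
  then show "c \<in> {c \<in> carrier C. principal C c \<inter> I \<subseteq> I'}"
    using c unfolding principal_def by blast
qed auto

lemma Id_frame_carrier: "carrier (Id_frame C J) = {I. is_ideal C J I}"
  by (simp add: Id_frame_def)

lemma Id_frame_le: "I \<sqsubseteq>\<^bsub>Id_frame C J\<^esub> I' \<longleftrightarrow> is_ideal C J I \<and> is_ideal C J I' \<and> I \<subseteq> I'"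
  by (simp add: Id_frame_def)

lemma Id_frame_poset: "poset (Id_frame C J)"
  by (rule posetI) (auto simp: Id_frame_def)

lemma Union_ideals_subset: "A \<subseteq> carrier (Id_frame C J) \<Longrightarrow> \<Union>A \<subseteq> carrier C"
  using ideal_subset unfolding Id_frame_carrier by blast

lemma Id_frame_is_lub:
  assumes A: "A \<subseteq> carrier (Id_frame C J)"
  shows "is_lub (Id_frame C J) (generated_ideal C J (\<Union>A)) A"
proof -
  have "is_ideal C J (generated_ideal C J (\<Union>A))"
    by (rule generated_ideal_is_ideal[OF Union_ideals_subset[OF A]])
  moreover have "a \<subseteq> generated_ideal C J (\<Union>A)" if "a \<in> A" for a
    using that generated_ideal_superset[of "\<Union>A"] by blast
  ultimately show ?thesis
    using A generated_ideal_least[of _ "\<Union>A"]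
    unfolding is_lub_iff[OF A] Id_frame_le Id_frame_carrier by (auto simp: Sup_le_iff)
qed

lemma Id_frame_Sup:
  assumes A: "A \<subseteq> carrier (Id_frame C J)"
  shows "\<Squnion>\<^bsub>Id_frame C J\<^esub> A = generated_ideal C J (\<Union>A)"
  by (rule poset_is_lub_Sup[OF Id_frame_poset Id_frame_is_lub[OF A]])

lemma Id_frame_meet:
  "is_ideal C J I \<Longrightarrow> is_ideal C J I' \<Longrightarrow> I \<sqinter>\<^bsub>Id_frame C J\<^esub> I' = I \<inter> I'"
  by (rule poset_meet_eqI[OF Id_frame_poset]) (auto simp: Id_frame_carrier Id_frame_le ideal_Int)

lemma Id_frame_top: "\<top>\<^bsub>Id_frame C J\<^esub> = carrier C"
  by (rule poset_top_eqI[OF Id_frame_poset])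
    (auto simp: Id_frame_carrier Id_frame_le ideal_carrier dest: ideal_subset)

lemma frame_Id_frame: "frame (Id_frame C J)"
proof (rule frameI[OF Id_frame_poset])
  show "\<exists>s. is_lub (Id_frame C J) s A" if "A \<subseteq> carrier (Id_frame C J)" for A
    using Id_frame_is_lub[OF that] by blast
  fix A s x y u
  assume A: "A \<subseteq> carrier (Id_frame C J)" and s: "is_lub (Id_frame C J) s A"
    and yx: "y \<sqsubseteq>\<^bsub>Id_frame C J\<^esub> x" and ys: "y \<sqsubseteq>\<^bsub>Id_frame C J\<^esub> s" and u: "u \<in> carrier (Id_frame C J)"
    and le: "\<And>a w. \<lbrakk>a \<in> A; w \<sqsubseteq>\<^bsub>Id_frame C J\<^esub> x; w \<sqsubseteq>\<^bsub>Id_frame C J\<^esub> a\<rbrakk> \<Longrightarrow> w \<sqsubseteq>\<^bsub>Id_frame C J\<^esub> u"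
  have x: "is_ideal C J x" and y: "is_ideal C J y" and u': "is_ideal C J u"
    using yx u by (simp_all add: Id_frame_le Id_frame_carrier)
  have s_eq: "s = generated_ideal C J (\<Union>A)"
    using poset_is_lub_Sup[OF Id_frame_poset s] Id_frame_Sup[OF A] by simp
  have "a \<subseteq> {c \<in> carrier C. principal C c \<inter> x \<subseteq> u}" if a: "a \<in> A" for a
  proof -
    have ia: "is_ideal C J a"
      using a A by (auto simp: Id_frame_carrier)
    have "x \<inter> a \<subseteq> u"
      using le[OF a, of "x \<inter> a"] x ia ideal_Int by (simp add: Id_frame_le)
    then show ?thesis
      using ideal_subset[OF ia] ideal_lower[OF ia] unfolding principal_def by blast
  qed
  then have "s \<subseteq> {c \<in> carrier C. principal C c \<inter> x \<subseteq> u}"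
    unfolding s_eq by (intro generated_ideal_least[OF ideal_implication[OF x u']]) blast
  moreover have "c \<in> principal C c \<inter> x" if "c \<in> y" for c
    using that yx ideal_subset[OF y] poset_refl[OF is_poset] unfolding principal_def Id_frame_le by blast
  ultimately show "y \<sqsubseteq>\<^bsub>Id_frame C J\<^esub> u"
    using ys y u' unfolding Id_frame_le by blast
qed

lemma principal_generates:
  assumes "is_ideal C J I"
  shows "generated_ideal C J (\<Union>(principal C ` I)) = I"
proof
  show "generated_ideal C J (\<Union>(principal C ` I)) \<subseteq> I"
    using ideal_lower[OF assms] by (intro generated_ideal_least[OF assms]) (auto simp: principal_def)
  have "I \<subseteq> \<Union>(principal C ` I)"
    using ideal_subset[OF assms] poset_refl[OF is_poset] unfolding principal_def by blast
  then show "I \<subseteq> generated_ideal C J (\<Union>(principal C ` I))"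
    using generated_ideal_superset by blast
qed

end

locale subcanonical_site = site +
  assumes subcanonical: "subcanonical C J"
begin

text \<open>
  An ideal must contain \<open>d\<close> once it contains a covering sieve on \<open>d\<close>. For \<open>\<down>c\<close> this says that an upper
  bound \<open>c\<close> of a covering sieve on \<open>d\<close> lies above \<open>d\<close>: that is subcanonicity.
\<close>

lemma principal_ideal:
  assumes c: "c \<in> carrier C"
  shows "is_ideal C J (principal C c)"
proof (rule idealI)
  fix d S assume d: "d \<in> carrier C" and S: "S \<in> J d" and sub: "S \<subseteq> principal C c"
  have "is_lub C d S"
    using subcanonical d S unfolding subcanonical_def by blast
  then have "d \<sqsubseteq>\<^bsub>C\<^esub> c"
    using sub c unfolding is_lub_iff[OF cover_sieve(1)[OF d S]] principal_def by blast
  then show "d \<in> principal C c"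
    using d by (simp add: principal_def)
qed (use poset_le_closed[OF is_poset] poset_trans[OF is_poset] in \<open>auto simp: principal_def\<close>)

lemma Sup_principal:
  assumes "is_ideal C J I"
  shows "\<Squnion>\<^bsub>Id_frame C J\<^esub> (principal C ` I) = I"
  using ideal_subset[OF assms] principal_ideal principal_generates[OF assms]
  by (subst Id_frame_Sup) (auto simp: Id_frame_carrier)

lemma frame_homs_eq_on_principals:
  assumes h: "h \<in> frame_homs (Id_frame C J) L" and k: "k \<in> frame_homs (Id_frame C J) L"
    and eq: "\<And>c. c \<in> carrier C \<Longrightarrow> h (principal C c) = k (principal C c)"
  shows "h = k"
proof (rule extensionalityI[OF frame_hom_extensional[OF h] frame_hom_extensional[OF k]])
  fix I assume "I \<in> carrier (Id_frame C J)"
  then have I: "is_ideal C J I"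
    by (simp add: Id_frame_carrier)
  then have sub: "principal C ` I \<subseteq> carrier (Id_frame C J)"
    using ideal_subset principal_ideal by (auto simp: Id_frame_carrier)
  have "h ` principal C ` I = k ` principal C ` I"
    unfolding image_image using eq ideal_subset[OF I] by (intro image_cong) auto
  then show "h I = k I"
    using frame_hom_Sup[OF h sub] frame_hom_Sup[OF k sub] by (simp add: Sup_principal[OF I])
qed

end


section \<open>The universal property of the frame of ideals\<close>

text \<open>These maps are the arrows from \<open>C\<close> to a frame \<open>L\<close> in the category of the adjunction.\<close>

definition cover_preserving_filtering ::
  "'a gorder \<Rightarrow> ('a \<Rightarrow> 'a set set) \<Rightarrow> 'b gorder \<Rightarrow> ('a \<Rightarrow> 'b) set"
  where "cover_preserving_filtering C J L =
    {f \<in> carrier C \<rightarrow>\<^sub>E carrier L. filtering C L f \<and> sends_covers_to_covers C J L f}"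

lemma filtering_mono: "filtering C L f \<Longrightarrow> x \<in> carrier C \<Longrightarrow> y \<in> carrier C \<Longrightarrow> x \<sqsubseteq>\<^bsub>C\<^esub> y \<Longrightarrow> f x \<sqsubseteq>\<^bsub>L\<^esub> f y"
  unfolding filtering_def isotone_def by blast

definition ideal_extension ::
  "'a gorder \<Rightarrow> ('a \<Rightarrow> 'a set set) \<Rightarrow> 'b gorder \<Rightarrow> ('a \<Rightarrow> 'b) \<Rightarrow> 'a set \<Rightarrow> 'b"
  where "ideal_extension C J L f = (\<lambda>I \<in> carrier (Id_frame C J). \<Squnion>\<^bsub>L\<^esub> (f ` I))"

context site
begin

context
  fixes L :: "'b gorder" and f :: "'a \<Rightarrow> 'b"
  assumes L: "frame L" and f: "f \<in> cover_preserving_filtering C J L"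
begin

lemma image_closed: "X \<subseteq> carrier C \<Longrightarrow> f ` X \<subseteq> carrier L"
  using f unfolding cover_preserving_filtering_def by blast

lemma map_mono: "x \<sqsubseteq>\<^bsub>C\<^esub> y \<Longrightarrow> f x \<sqsubseteq>\<^bsub>L\<^esub> f y"
  using f poset_le_closed[OF is_poset] filtering_mono[of C L f] unfolding cover_preserving_filtering_def by blast

text \<open>
  The elements sent below \<open>u\<close> form an ideal because \<open>f\<close> preserves covers; hence the supremum of
  the image of a set does not change when passing to the generated ideal.
\<close>

lemma ideal_below:
  assumes u: "u \<in> carrier L"
  shows "is_ideal C J {c \<in> carrier C. f c \<sqsubseteq>\<^bsub>L\<^esub> u}"
proof (rule idealI)
  show "y \<in> {c \<in> carrier C. f c \<sqsubseteq>\<^bsub>L\<^esub> u}" if "x \<in> {c \<in> carrier C. f c \<sqsubseteq>\<^bsub>L\<^esub> u}" "y \<sqsubseteq>\<^bsub>C\<^esub> x" for x y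
    using that map_mono[OF that(2)] poset_le_closed[OF is_poset] poset_trans[OF frame_poset[OF L]] by blast
  fix c S assume c: "c \<in> carrier C" and S: "S \<in> J c" and sub: "S \<subseteq> {c \<in> carrier C. f c \<sqsubseteq>\<^bsub>L\<^esub> u}"
  have "f c = \<Squnion>\<^bsub>L\<^esub> (f ` S)"
    using f c S unfolding cover_preserving_filtering_def sends_covers_to_covers_def by blast
  also have "\<dots> \<sqsubseteq>\<^bsub>L\<^esub> u"
    using sub by (intro frame_Sup_le[OF L _ u] image_closed) auto
  finally show "c \<in> {c \<in> carrier C. f c \<sqsubseteq>\<^bsub>L\<^esub> u}"
    using c by blast
qed auto

lemma Sup_image_generated_ideal:
  assumes X: "X \<subseteq> carrier C"
  shows "\<Squnion>\<^bsub>L\<^esub> (f ` generated_ideal C J X) = \<Squnion>\<^bsub>L\<^esub> (f ` X)"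
proof (rule poset_antisym[OF frame_poset[OF L]])
  have fX: "f ` X \<subseteq> carrier L" and fg: "f ` generated_ideal C J X \<subseteq> carrier L"
    using image_closed X ideal_subset[OF generated_ideal_is_ideal[OF X]] by blast+
  have "X \<subseteq> {c \<in> carrier C. f c \<sqsubseteq>\<^bsub>L\<^esub> \<Squnion>\<^bsub>L\<^esub> (f ` X)}"
    using X frame_le_Sup[OF L fX] by blast
  then have "generated_ideal C J X \<subseteq> {c \<in> carrier C. f c \<sqsubseteq>\<^bsub>L\<^esub> \<Squnion>\<^bsub>L\<^esub> (f ` X)}"
    by (rule generated_ideal_least[OF ideal_below[OF frame_Sup_closed[OF L fX]]])
  then show "\<Squnion>\<^bsub>L\<^esub> (f ` generated_ideal C J X) \<sqsubseteq>\<^bsub>L\<^esub> \<Squnion>\<^bsub>L\<^esub> (f ` X)"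
    by (intro frame_Sup_le[OF L fg frame_Sup_closed[OF L fX]]) blast
  show "\<Squnion>\<^bsub>L\<^esub> (f ` X) \<sqsubseteq>\<^bsub>L\<^esub> \<Squnion>\<^bsub>L\<^esub> (f ` generated_ideal C J X)"
    using generated_ideal_superset[of X] frame_le_Sup[OF L fg]
    by (intro frame_Sup_le[OF L fX frame_Sup_closed[OF L fg]]) blast
qed

text \<open>
  Distributing twice reduces the nontrivial inequality to \<open>f c' \<sqinter> f c\<close> with \<open>c \<in> I\<close> and \<open>c' \<in> I'\<close>. As \<open>f\<close> is
  filtering, this is a supremum of values at common lower bounds of \<open>c\<close> and \<open>c'\<close>, which lie in both ideals.
\<close>

lemma Sup_image_Int:
  assumes I: "is_ideal C J I" and I': "is_ideal C J I'"
  shows "\<Squnion>\<^bsub>L\<^esub> (f ` (I \<inter> I')) = \<Squnion>\<^bsub>L\<^esub> (f ` I) \<sqinter>\<^bsub>L\<^esub> \<Squnion>\<^bsub>L\<^esub> (f ` I')" (is "?u = ?v \<sqinter>\<^bsub>L\<^esub> ?w")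
proof (rule poset_antisym[OF frame_poset[OF L]])
  have fI: "f ` I \<subseteq> carrier L" and fI': "f ` I' \<subseteq> carrier L" and fII: "f ` (I \<inter> I') \<subseteq> carrier L"
    using image_closed ideal_subset[OF I] ideal_subset[OF I'] by blast+
  have u: "?u \<in> carrier L" and v: "?v \<in> carrier L" and w: "?w \<in> carrier L"
    using frame_Sup_closed[OF L] fI fI' fII by blast+
  have "?u \<sqsubseteq>\<^bsub>L\<^esub> ?v"
    using frame_le_Sup[OF L fI] by (intro frame_Sup_le[OF L fII v]) blast
  moreover have "?u \<sqsubseteq>\<^bsub>L\<^esub> ?w"
    using frame_le_Sup[OF L fI'] by (intro frame_Sup_le[OF L fII w]) blast
  ultimately show "?u \<sqsubseteq>\<^bsub>L\<^esub> ?v \<sqinter>\<^bsub>L\<^esub> ?w"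
    using frame_meet[OF L v w] by blast
  have meet_commute: "x \<sqinter>\<^bsub>L\<^esub> y = y \<sqinter>\<^bsub>L\<^esub> x" for x y
    unfolding meet_def by (simp add: insert_commute)
  have base: "f c' \<sqinter>\<^bsub>L\<^esub> f c \<sqsubseteq>\<^bsub>L\<^esub> ?u" if c: "c \<in> I" "c' \<in> I'" for c c'
  proof -
    have "f c' \<sqinter>\<^bsub>L\<^esub> f c = \<Squnion>\<^bsub>L\<^esub> {f b | b. b \<in> carrier C \<and> b \<sqsubseteq>\<^bsub>C\<^esub> c' \<and> b \<sqsubseteq>\<^bsub>C\<^esub> c}"
      using f c ideal_subset[OF I] ideal_subset[OF I']
      unfolding cover_preserving_filtering_def filtering_def by blast
    also have "\<dots> \<sqsubseteq>\<^bsub>L\<^esub> ?u"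
      using image_closed[of "carrier C"] ideal_lower[OF I c(1)] ideal_lower[OF I' c(2)]
      by (intro frame_Sup_le[OF L _ u]) (auto intro!: frame_le_Sup[OF L fII])
    finally show ?thesis .
  qed
  have "?v \<sqinter>\<^bsub>L\<^esub> f c' \<sqsubseteq>\<^bsub>L\<^esub> ?u" if c': "c' \<in> I'" for c'
    unfolding meet_commute[of ?v]
    using c' fI' base by (intro frame_meet_Sup_le[OF L fI _ u]) auto
  then show "?v \<sqinter>\<^bsub>L\<^esub> ?w \<sqsubseteq>\<^bsub>L\<^esub> ?u"
    by (intro frame_meet_Sup_le[OF L fI' v u]) blast
qed

lemma Sup_image_Union:
  assumes A: "\<And>X. X \<in> A \<Longrightarrow> X \<subseteq> carrier C"
  shows "\<Squnion>\<^bsub>L\<^esub> (f ` \<Union>A) = \<Squnion>\<^bsub>L\<^esub> ((\<lambda>X. \<Squnion>\<^bsub>L\<^esub> (f ` X)) ` A)"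
proof -
  have fX: "f ` X \<subseteq> carrier L" if "X \<in> A" for X
    using image_closed A[OF that] .
  have S: "(\<lambda>X. \<Squnion>\<^bsub>L\<^esub> (f ` X)) ` A \<subseteq> carrier L"
    using frame_Sup_closed[OF L fX] by blast
  show ?thesis
  proof (rule poset_Sup_eqI[OF frame_poset[OF L]])
    show "f ` \<Union>A \<subseteq> carrier L"
      using fX by blast
    show "\<Squnion>\<^bsub>L\<^esub> ((\<lambda>X. \<Squnion>\<^bsub>L\<^esub> (f ` X)) ` A) \<in> carrier L"
      by (rule frame_Sup_closed[OF L S])
    show "a \<sqsubseteq>\<^bsub>L\<^esub> \<Squnion>\<^bsub>L\<^esub> ((\<lambda>X. \<Squnion>\<^bsub>L\<^esub> (f ` X)) ` A)" if a: "a \<in> f ` \<Union>A" for a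
    proof -
      obtain X where X: "X \<in> A" "a \<in> f ` X"
        using a by blast
      show ?thesis
        by (rule poset_trans[OF frame_poset[OF L] frame_le_Sup[OF L fX[OF X(1)] X(2)]
              frame_le_Sup[OF L S imageI[OF X(1)]]])
    qed
    show "\<Squnion>\<^bsub>L\<^esub> ((\<lambda>X. \<Squnion>\<^bsub>L\<^esub> (f ` X)) ` A) \<sqsubseteq>\<^bsub>L\<^esub> u"
      if "u \<in> carrier L" "\<And>a. a \<in> f ` \<Union>A \<Longrightarrow> a \<sqsubseteq>\<^bsub>L\<^esub> u" for u
    proof (rule frame_Sup_le[OF L S that(1)])
      fix b assume "b \<in> (\<lambda>X. \<Squnion>\<^bsub>L\<^esub> (f ` X)) ` A"
      then obtain X where X: "X \<in> A" "b = \<Squnion>\<^bsub>L\<^esub> (f ` X)"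
        by blast
      show "b \<sqsubseteq>\<^bsub>L\<^esub> u"
        unfolding X(2) using X(1) that(2) by (intro frame_Sup_le[OF L fX that(1)]) auto
    qed
  qed
qed

lemma ideal_extension_frame_hom: "ideal_extension C J L f \<in> frame_homs (Id_frame C J) L"
  unfolding frame_homs_def
proof (intro CollectI conjI ballI allI impI)
  show "ideal_extension C J L f \<in> carrier (Id_frame C J) \<rightarrow>\<^sub>E carrier L"
    unfolding ideal_extension_def
    using frame_Sup_closed[OF L image_closed[OF ideal_subset]] by (auto simp: Id_frame_carrier)
  show "ideal_extension C J L f \<top>\<^bsub>Id_frame C J\<^esub> = \<top>\<^bsub>L\<^esub>"
    using f ideal_carrier
    unfolding ideal_extension_def cover_preserving_filtering_def filtering_def Id_frame_top
    by (simp add: Id_frame_carrier)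
  show "ideal_extension C J L f (I \<sqinter>\<^bsub>Id_frame C J\<^esub> I')
      = ideal_extension C J L f I \<sqinter>\<^bsub>L\<^esub> ideal_extension C J L f I'"
    if "I \<in> carrier (Id_frame C J)" "I' \<in> carrier (Id_frame C J)" for I I'
    using that Sup_image_Int ideal_Int
    unfolding ideal_extension_def by (simp add: Id_frame_carrier Id_frame_meet)
  show "ideal_extension C J L f (\<Squnion>\<^bsub>Id_frame C J\<^esub> A) = \<Squnion>\<^bsub>L\<^esub> (ideal_extension C J L f ` A)"
    if A: "A \<subseteq> carrier (Id_frame C J)" for A
  proof -
    have "ideal_extension C J L f (\<Squnion>\<^bsub>Id_frame C J\<^esub> A) = \<Squnion>\<^bsub>L\<^esub> (f ` generated_ideal C J (\<Union>A))"
      using generated_ideal_is_ideal[OF Union_ideals_subset[OF A]]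
      unfolding ideal_extension_def Id_frame_Sup[OF A] by (simp add: Id_frame_carrier)
    also have "\<dots> = \<Squnion>\<^bsub>L\<^esub> ((\<lambda>X. \<Squnion>\<^bsub>L\<^esub> (f ` X)) ` A)"
      unfolding Sup_image_generated_ideal[OF Union_ideals_subset[OF A]]
      using Union_ideals_subset[OF A] by (intro Sup_image_Union) blast
    also have "(\<lambda>X. \<Squnion>\<^bsub>L\<^esub> (f ` X)) ` A = ideal_extension C J L f ` A"
      using A unfolding ideal_extension_def by (intro image_cong) auto
    finally show ?thesis .
  qed
qed

end

end

context subcanonical_site
begin

lemma ideal_extension_principal:
  assumes L: "frame L" and f: "f \<in> cover_preserving_filtering C J L" and c: "c \<in> carrier C"
  shows "ideal_extension C J L f (principal C c) = f c"
proof -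
  have "\<Squnion>\<^bsub>L\<^esub> (f ` principal C c) = f c"
  proof (rule poset_Sup_eqI[OF frame_poset[OF L]])
    show "f ` principal C c \<subseteq> carrier L" "f c \<in> carrier L"
      using image_closed[OF L f, of "carrier C"] c by (auto simp: principal_def)
  qed (use c map_mono[OF L f] poset_refl[OF is_poset c] in \<open>auto simp: principal_def\<close>)
  then show ?thesis
    using principal_ideal[OF c] by (simp add: ideal_extension_def Id_frame_carrier)
qed

end

context site
begin

lemma compose_frame_hom:
  assumes L: "frame L" and M: "frame M"
    and f: "f \<in> cover_preserving_filtering C J L" and h: "h \<in> frame_homs L M"
  shows "compose (carrier C) h f \<in> cover_preserving_filtering C J M"
proof -
  let ?k = "compose (carrier C) h f"
  have im: "?k ` X = h ` f ` X" if "X \<subseteq> carrier C" for X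
    unfolding image_image using that by (intro image_cong) (auto simp: compose_eq)
  have hSup: "h (\<Squnion>\<^bsub>L\<^esub> (f ` X)) = \<Squnion>\<^bsub>M\<^esub> (?k ` X)" if X: "X \<subseteq> carrier C" for X
    unfolding im[OF X] by (rule frame_hom_Sup[OF h image_closed[OF L f X]])
  have fc: "f c \<in> carrier L" if "c \<in> carrier C" for c
    using image_closed[OF L f] that by blast
  have "isotone C M ?k"
    unfolding isotone_def
    using poset_weak[OF is_poset] poset_weak[OF frame_poset[OF M]]
      frame_hom_mono[OF L M h map_mono[OF L f]] by (simp add: compose_eq)
  moreover have "\<top>\<^bsub>M\<^esub> = \<Squnion>\<^bsub>M\<^esub> (?k ` carrier C)"
  proof -
    have "\<top>\<^bsub>L\<^esub> = \<Squnion>\<^bsub>L\<^esub> (f ` carrier C)"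
      using f unfolding cover_preserving_filtering_def filtering_def by blast
    then show ?thesis
      using hSup[of "carrier C"] frame_hom_top[OF h] by simp
  qed
  moreover have "?k c \<sqinter>\<^bsub>M\<^esub> ?k c' = \<Squnion>\<^bsub>M\<^esub> {?k b | b. b \<in> carrier C \<and> b \<sqsubseteq>\<^bsub>C\<^esub> c \<and> b \<sqsubseteq>\<^bsub>C\<^esub> c'}"
    if c: "c \<in> carrier C" "c' \<in> carrier C" for c c'
  proof -
    let ?B = "{b. b \<in> carrier C \<and> b \<sqsubseteq>\<^bsub>C\<^esub> c \<and> b \<sqsubseteq>\<^bsub>C\<^esub> c'}"
    have "f c \<sqinter>\<^bsub>L\<^esub> f c' = \<Squnion>\<^bsub>L\<^esub> (f ` ?B)"
      using f c unfolding cover_preserving_filtering_def filtering_def image_Collect by blast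
    then have "h (f c \<sqinter>\<^bsub>L\<^esub> f c') = \<Squnion>\<^bsub>M\<^esub> (?k ` ?B)"
      using hSup[of ?B] by auto
    then have "?k c \<sqinter>\<^bsub>M\<^esub> ?k c' = \<Squnion>\<^bsub>M\<^esub> (?k ` ?B)"
      by (simp only: frame_hom_meet[OF h fc[OF c(1)] fc[OF c(2)]] compose_eq[OF c(1)] compose_eq[OF c(2)])
    then show ?thesis
      unfolding image_Collect .
  qed
  moreover have "?k c = \<Squnion>\<^bsub>M\<^esub> (?k ` S)" if c: "c \<in> carrier C" "S \<in> J c" for c S
  proof -
    have "f c = \<Squnion>\<^bsub>L\<^esub> (f ` S)"
      using f c unfolding cover_preserving_filtering_def sends_covers_to_covers_def by blast
    then show ?thesis
      using hSup[OF cover_sieve(1)[OF c]] c by (simp add: compose_eq)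
  qed
  moreover have "?k \<in> carrier C \<rightarrow>\<^sub>E carrier M"
    using fc frame_hom_closed[OF h] by (auto simp: compose_def)
  ultimately show ?thesis
    unfolding cover_preserving_filtering_def filtering_def sends_covers_to_covers_def by blast
qed

end

text \<open>
  This provides the forgetful functor on arrows. A covering sieve on \<open>c\<close> has supremum \<open>c\<close> by
  subcanonicity, and \<open>f\<close> preserves suprema. In a frame the common lower bounds of \<open>c\<close> and \<open>c'\<close> have a
  greatest element, so that preserving binary meets gives the last condition for a filtering map.
\<close>

lemma (in subcanonical_site) frame_hom_cover_preserving_filtering:
  assumes C: "frame C" and L: "frame L" and f: "f \<in> frame_homs C L"
  shows "f \<in> cover_preserving_filtering C J L"
proof -
  have fc: "f c \<in> carrier L" if "c \<in> carrier C" for c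
    by (rule frame_hom_closed[OF f that])
  have "isotone C L f"
    unfolding isotone_def
    using poset_weak[OF is_poset] poset_weak[OF frame_poset[OF L]] frame_hom_mono[OF C L f] by simp
  moreover have "\<top>\<^bsub>L\<^esub> = \<Squnion>\<^bsub>L\<^esub> (f ` carrier C)"
  proof (rule HOL.sym, rule poset_Sup_eqI[OF frame_poset[OF L]])
    show "u \<in> carrier L \<Longrightarrow> (\<And>a. a \<in> f ` carrier C \<Longrightarrow> a \<sqsubseteq>\<^bsub>L\<^esub> u) \<Longrightarrow> \<top>\<^bsub>L\<^esub> \<sqsubseteq>\<^bsub>L\<^esub> u" for u
      using frame_top[OF C] frame_hom_top[OF f] by (metis imageI)
  qed (use fc frame_top[OF L] in auto)
  moreover have "f c \<sqinter>\<^bsub>L\<^esub> f c' = \<Squnion>\<^bsub>L\<^esub> {f b | b. b \<in> carrier C \<and> b \<sqsubseteq>\<^bsub>C\<^esub> c \<and> b \<sqsubseteq>\<^bsub>C\<^esub> c'}"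
    if c: "c \<in> carrier C" "c' \<in> carrier C" for c c'
  proof (rule HOL.sym, rule poset_Sup_eqI[OF frame_poset[OF L]])
    note m = frame_meet[OF C c] and fm = frame_hom_meet[OF f c]
    show "f c \<sqinter>\<^bsub>L\<^esub> f c' \<in> carrier L"
      using m fm fc by metis
    show "a \<sqsubseteq>\<^bsub>L\<^esub> f c \<sqinter>\<^bsub>L\<^esub> f c'" if a: "a \<in> {f b | b. b \<in> carrier C \<and> b \<sqsubseteq>\<^bsub>C\<^esub> c \<and> b \<sqsubseteq>\<^bsub>C\<^esub> c'}" for a
      using a m frame_hom_mono[OF C L f] unfolding fm[symmetric] by blast
    show "f c \<sqinter>\<^bsub>L\<^esub> f c' \<sqsubseteq>\<^bsub>L\<^esub> u"
      if "\<And>a. a \<in> {f b | b. b \<in> carrier C \<and> b \<sqsubseteq>\<^bsub>C\<^esub> c \<and> b \<sqsubseteq>\<^bsub>C\<^esub> c'} \<Longrightarrow> a \<sqsubseteq>\<^bsub>L\<^esub> u" for u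
      unfolding fm[symmetric] using m by (intro that) blast
  qed (use fc in auto)
  moreover have "f c = \<Squnion>\<^bsub>L\<^esub> (f ` S)" if c: "c \<in> carrier C" and S: "S \<in> J c" for c S
  proof -
    note sub = cover_sieve(1)[OF c S]
    have "is_lub C c S"
      using subcanonical c S unfolding subcanonical_def by blast
    then have "\<Squnion>\<^bsub>C\<^esub> S = c"
      by (rule poset_is_lub_Sup[OF is_poset])
    then show ?thesis
      using frame_hom_Sup[OF f sub] by simp
  qed
  moreover have "f \<in> carrier C \<rightarrow>\<^sub>E carrier L"
    using f unfolding frame_homs_def by blast
  ultimately show ?thesis
    unfolding cover_preserving_filtering_def filtering_def sends_covers_to_covers_def by blast
qed


section \<open>Functoriality\<close>

text \<open>
  The three conditions on a morphism of sites correspond in turn to the condition on the top element,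
  the condition on binary meets, and the preservation of covers. For the first two the required
  suprema of ideals are already unions of the \<open>\<down>f(c)\<close>; for the last, the union of the \<open>\<down>f(s)\<close> with
  \<open>s \<in> S\<close> is a covering sieve on \<open>f c\<close>, so the ideal that it generates contains \<open>f c\<close>.
\<close>

lemma principal_site_morphism:
  assumes C: "site C J" and D: "subcanonical_site D K" and f: "f \<in> site_morphisms C J D K"
  shows "(\<lambda>c \<in> carrier C. principal D (f c)) \<in> cover_preserving_filtering C J (Id_frame D K)"
proof -
  interpret C: site C J by (rule C)
  interpret D: subcanonical_site D K by (rule D)
  define p where "p = (\<lambda>c \<in> carrier C. principal D (f c))"
  have fc: "f c \<in> carrier D" if "c \<in> carrier C" for c
    using f that unfolding site_morphisms_def by blast
  have p: "p c = principal D (f c)" "is_ideal D K (p c)" if "c \<in> carrier C" for c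
    using that D.principal_ideal[OF fc[OF that]] by (simp_all add: p_def)
  have p_sub: "p ` X \<subseteq> carrier (Id_frame D K)" if "X \<subseteq> carrier C" for X
    using p(2) that unfolding D.Id_frame_carrier by blast
  have p_mono: "p x \<subseteq> p y" if xy: "x \<sqsubseteq>\<^bsub>C\<^esub> y" for x y
  proof -
    have c: "x \<in> carrier C" "y \<in> carrier C"
      using poset_le_closed[OF C.is_poset xy] by blast+
    then have "f x \<sqsubseteq>\<^bsub>D\<^esub> f y"
      using f xy unfolding site_morphisms_def isotone_def by blast
    then have "principal D (f x) \<subseteq> principal D (f y)"
      using poset_trans[OF D.is_poset] unfolding principal_def by blast
    then show ?thesis
      unfolding p(1)[OF c(1)] p(1)[OF c(2)] .
  qed
  have "isotone C (Id_frame D K) p"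
    using poset_weak[OF C.is_poset] poset_weak[OF D.Id_frame_poset] p(2) p_mono
    by (simp add: isotone_def D.Id_frame_le)
  moreover have "\<top>\<^bsub>Id_frame D K\<^esub> = \<Squnion>\<^bsub>Id_frame D K\<^esub> (p ` carrier C)"
  proof -
    have "carrier D \<subseteq> \<Union>(p ` carrier C)"
    proof
      fix d assume d: "d \<in> carrier D"
      then obtain c where c: "c \<in> carrier C" "d \<sqsubseteq>\<^bsub>D\<^esub> f c"
        using f unfolding site_morphisms_def by blast
      then have "d \<in> p c"
        using d by (simp add: p(1) principal_def)
      then show "d \<in> \<Union>(p ` carrier C)"
        using c(1) by blast
    qed
    then have "carrier D \<subseteq> generated_ideal D K (\<Union>(p ` carrier C))"
      using D.generated_ideal_superset by blast
    moreover note D.ideal_subset[OF D.generated_ideal_is_ideal[OF D.Union_ideals_subset[OF p_sub[OF subset_refl]]]]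
    ultimately show ?thesis
      unfolding D.Id_frame_top D.Id_frame_Sup[OF p_sub[OF subset_refl]] by (rule subset_antisym)
  qed
  moreover have "p c \<sqinter>\<^bsub>Id_frame D K\<^esub> p c'
      = \<Squnion>\<^bsub>Id_frame D K\<^esub> {p b | b. b \<in> carrier C \<and> b \<sqsubseteq>\<^bsub>C\<^esub> c \<and> b \<sqsubseteq>\<^bsub>C\<^esub> c'}"
    if c: "c \<in> carrier C" "c' \<in> carrier C" for c c'
  proof -
    let ?B = "{b. b \<in> carrier C \<and> b \<sqsubseteq>\<^bsub>C\<^esub> c \<and> b \<sqsubseteq>\<^bsub>C\<^esub> c'}"
    have B: "?B \<subseteq> carrier C"
      by blast
    have "p c \<inter> p c' \<subseteq> \<Union>(p ` ?B)"
    proof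
      fix d assume "d \<in> p c \<inter> p c'"
      then have d: "d \<in> carrier D" "d \<sqsubseteq>\<^bsub>D\<^esub> f c" "d \<sqsubseteq>\<^bsub>D\<^esub> f c'"
        using c by (simp_all add: p(1) principal_def)
      then obtain b where b: "b \<in> ?B" "d \<sqsubseteq>\<^bsub>D\<^esub> f b"
        using f c unfolding site_morphisms_def by blast
      then have "d \<in> p b"
        using d(1) by (simp add: p(1) principal_def)
      then show "d \<in> \<Union>(p ` ?B)"
        using b(1) by blast
    qed
    then have "p c \<inter> p c' \<subseteq> generated_ideal D K (\<Union>(p ` ?B))"
      using D.generated_ideal_superset by blast
    moreover have "\<Union>(p ` ?B) \<subseteq> p c \<inter> p c'"
      using p_mono by blast
    then have "generated_ideal D K (\<Union>(p ` ?B)) \<subseteq> p c \<inter> p c'"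
      by (rule D.generated_ideal_least[OF D.ideal_Int[OF p(2)[OF c(1)] p(2)[OF c(2)]]])
    ultimately have "p c \<inter> p c' = generated_ideal D K (\<Union>(p ` ?B))"
      by (rule subset_antisym)
    then have "p c \<sqinter>\<^bsub>Id_frame D K\<^esub> p c' = \<Squnion>\<^bsub>Id_frame D K\<^esub> (p ` ?B)"
      unfolding D.Id_frame_meet[OF p(2)[OF c(1)] p(2)[OF c(2)]] D.Id_frame_Sup[OF p_sub[OF B]] .
    then show ?thesis
      unfolding image_Collect .
  qed
  moreover have "p c = \<Squnion>\<^bsub>Id_frame D K\<^esub> (p ` S)" if c: "c \<in> carrier C" and S: "S \<in> J c" for c S
  proof -
    note sub = C.cover_sieve(1)[OF c S]
    have cov: "{d \<in> carrier D. \<exists>s \<in> S. d \<sqsubseteq>\<^bsub>D\<^esub> f s} \<in> K (f c)"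
      using f c S unfolding site_morphisms_def by blast
    have U: "\<Union>(p ` S) = {d \<in> carrier D. \<exists>s \<in> S. d \<sqsubseteq>\<^bsub>D\<^esub> f s}"
      using sub p(1) by (auto simp: principal_def)
    have g: "is_ideal D K (generated_ideal D K (\<Union>(p ` S)))"
      by (rule D.generated_ideal_is_ideal[OF D.Union_ideals_subset[OF p_sub[OF sub]]])
    have "f c \<in> generated_ideal D K (\<Union>(p ` S))"
      using D.generated_ideal_superset[of "\<Union>(p ` S)"]
      by (intro D.ideal_cover[OF g fc[OF c] cov]) (simp only: U)
    then have "p c \<subseteq> generated_ideal D K (\<Union>(p ` S))"
      using D.ideal_lower[OF g] unfolding p(1)[OF c] principal_def by blast
    moreover have "\<Union>(p ` S) \<subseteq> p c"
      using p_mono C.cover_sieve(2)[OF c S] by blast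
    then have "generated_ideal D K (\<Union>(p ` S)) \<subseteq> p c"
      by (rule D.generated_ideal_least[OF p(2)[OF c]])
    ultimately show ?thesis
      unfolding D.Id_frame_Sup[OF p_sub[OF sub]] by (rule subset_antisym)
  qed
  moreover have "p \<in> carrier C \<rightarrow>\<^sub>E carrier (Id_frame D K)"
    using p_sub[OF subset_refl] by (auto simp: p_def)
  ultimately show ?thesis
    unfolding p_def[symmetric] cover_preserving_filtering_def filtering_def sends_covers_to_covers_def by blast
qed

lemma Id_map_eq_ideal_extension:
  assumes C: "site C J" and D: "subcanonical_site D K" and f: "f \<in> site_morphisms C J D K"
  shows "Id_map C J D K f = ideal_extension C J (Id_frame D K) (\<lambda>c \<in> carrier C. principal D (f c))"
  unfolding Id_map_def ideal_extension_def
proof (rule restrict_ext)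
  interpret C: site C J by (rule C)
  interpret D: subcanonical_site D K by (rule D)
  fix I assume "I \<in> carrier (Id_frame C J)"
  then have I: "I \<subseteq> carrier C"
    using C.ideal_subset by (simp add: C.Id_frame_carrier)
  have fI: "f ` I \<subseteq> carrier D"
    using f I unfolding site_morphisms_def by blast
  have im: "(\<lambda>c \<in> carrier C. principal D (f c)) ` I = principal D ` f ` I"
    unfolding image_image using I by (intro image_cong) auto
  have sub: "principal D ` f ` I \<subseteq> carrier (Id_frame D K)"
    using D.principal_ideal fI by (auto simp: D.Id_frame_carrier)
  show "generated_ideal D K (f ` I) = \<Squnion>\<^bsub>Id_frame D K\<^esub> ((\<lambda>c \<in> carrier C. principal D (f c)) ` I)"
    unfolding im D.Id_frame_Sup[OF sub]
  proof
    have "f ` I \<subseteq> \<Union>(principal D ` f ` I)"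
    proof
      fix d assume d: "d \<in> f ` I"
      then show "d \<in> \<Union>(principal D ` f ` I)"
        using D.principal_self fI by (intro UnionI[OF imageI[OF d]]) blast
    qed
    also note D.generated_ideal_superset
    finally show "generated_ideal D K (f ` I) \<subseteq> generated_ideal D K (\<Union>(principal D ` f ` I))"
      by (rule D.generated_ideal_least[OF D.generated_ideal_is_ideal[OF D.Union_ideals_subset[OF sub]]])
    note g = D.generated_ideal_is_ideal[OF fI]
    have "\<Union>(principal D ` f ` I) \<subseteq> generated_ideal D K (f ` I)"
      using D.ideal_lower[OF g] D.generated_ideal_superset[of "f ` I"] by (auto simp: principal_def)
    then show "generated_ideal D K (\<Union>(principal D ` f ` I)) \<subseteq> generated_ideal D K (f ` I)"
      by (rule D.generated_ideal_least[OF g])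
  qed
qed

lemma Id_map_frame_hom:
  assumes C: "site C J" and D: "subcanonical_site D K" and f: "f \<in> site_morphisms C J D K"
  shows "Id_map C J D K f \<in> frame_homs (Id_frame C J) (Id_frame D K)"
  unfolding Id_map_eq_ideal_extension[OF assms]
  using D by (intro site.ideal_extension_frame_hom[OF C] principal_site_morphism[OF assms]
      site.frame_Id_frame) (simp add: subcanonical_site_def)

lemma Id_map_principal:
  assumes C: "subcanonical_site C J" and D: "subcanonical_site D K"
    and f: "f \<in> site_morphisms C J D K" and c: "c \<in> carrier C"
  shows "Id_map C J D K f (principal C c) = principal D (f c)"
proof -
  have sites: "site C J" "site D K"
    using C D by (simp_all add: subcanonical_site_def)
  show ?thesis
    unfolding Id_map_eq_ideal_extension[OF sites(1) D f]
    by (subst subcanonical_site.ideal_extension_principal[OF C site.frame_Id_frame[OF sites(2)]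
          principal_site_morphism[OF sites(1) D f] c]) (simp add: c)
qed

lemma (in subcanonical_site) principal_cover_preserving_filtering:
  "(\<lambda>c \<in> carrier C. principal C c) \<in> cover_preserving_filtering C J (Id_frame C J)"
proof -
  have "{d \<in> carrier C. \<exists>s \<in> S. d \<sqsubseteq>\<^bsub>C\<^esub> restrict id (carrier C) s} = S"
    if "c \<in> carrier C" "S \<in> J c" for c S
  proof
    show "{d \<in> carrier C. \<exists>s \<in> S. d \<sqsubseteq>\<^bsub>C\<^esub> restrict id (carrier C) s} \<subseteq> S"
      using cover_sieve(1,3)[OF that] by auto
    show "S \<subseteq> {d \<in> carrier C. \<exists>s \<in> S. d \<sqsubseteq>\<^bsub>C\<^esub> restrict id (carrier C) s}"
    proof
      fix s assume s: "s \<in> S"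
      then have "s \<in> carrier C"
        using cover_sieve(1)[OF that] by blast
      then show "s \<in> {d \<in> carrier C. \<exists>s \<in> S. d \<sqsubseteq>\<^bsub>C\<^esub> restrict id (carrier C) s}"
        using s poset_refl[OF is_poset] by (auto intro!: bexI[of _ s])
    qed
  qed
  moreover have "isotone C C (restrict id (carrier C))"
    using poset_weak[OF is_poset] by (simp add: isotone_def)
  moreover have "\<exists>c \<in> carrier C. d \<sqsubseteq>\<^bsub>C\<^esub> c" if "d \<in> carrier C" for d
    using that poset_refl[OF is_poset] by blast
  ultimately have "restrict id (carrier C) \<in> site_morphisms C J C J"
    using poset_refl[OF is_poset] by (auto simp: site_morphisms_def)
  from principal_site_morphism[OF site_axioms subcanonical_site_axioms this] show ?thesis
    by (simp cong: restrict_cong)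
qed


section \<open>Transport along a bijection\<close>

text \<open>
  The top element, binary meets and suprema are determined by the order. Applied to the inverse of
  \<open>f\<close>, once \<open>M\<close> is known to be a frame, the lemma shows that the inverse is a frame homomorphism too.
\<close>

lemma order_iso_frame:
  assumes L: "frame L" and M: "poset M" and f: "bij_betw f (carrier L) (carrier M)"
    and le: "\<And>x y. x \<in> carrier L \<Longrightarrow> y \<in> carrier L \<Longrightarrow> f x \<sqsubseteq>\<^bsub>M\<^esub> f y \<longleftrightarrow> x \<sqsubseteq>\<^bsub>L\<^esub> y"
  shows "frame M" and "restrict f (carrier L) \<in> frame_homs L M"
proof -
  have im: "carrier M = f ` carrier L"
    using f by (simp add: bij_betw_imp_surj_on)
  have lub: "is_lub M (f (\<Squnion>\<^bsub>L\<^esub> A)) (f ` A)" if A: "A \<subseteq> carrier L" for A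
  proof -
    have "f ` A \<subseteq> carrier M"
      using A im by blast
    moreover note S = frame_Sup_closed[OF L A]
    moreover have "f a \<sqsubseteq>\<^bsub>M\<^esub> f (\<Squnion>\<^bsub>L\<^esub> A)" if "a \<in> A" for a
      using le[of a "\<Squnion>\<^bsub>L\<^esub> A"] frame_le_Sup[OF L A that] that A S by blast
    moreover have "f (\<Squnion>\<^bsub>L\<^esub> A) \<sqsubseteq>\<^bsub>M\<^esub> f u" if "u \<in> carrier L" "\<forall>a \<in> A. f a \<sqsubseteq>\<^bsub>M\<^esub> f u" for u
    proof -
      have "a \<sqsubseteq>\<^bsub>L\<^esub> u" if "a \<in> A" for a
        using that A le[of a u] \<open>u \<in> carrier L\<close> \<open>\<forall>a \<in> A. f a \<sqsubseteq>\<^bsub>M\<^esub> f u\<close> by blast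
      then show ?thesis
        using le[OF S that(1)] frame_Sup_le[OF L A that(1)] by blast
    qed
    ultimately show ?thesis
      by (subst is_lub_iff) (auto simp: im)
  qed
  show frame_M: "frame M"
  proof (rule frameI[OF M])
    show "\<exists>s. is_lub M s A" if A: "A \<subseteq> carrier M" for A
    proof -
      obtain B where "B \<subseteq> carrier L" "A = f ` B"
        using A unfolding im subset_image_iff by blast
      then show ?thesis
        using lub by blast
    qed
    fix A s x y u
    assume A: "A \<subseteq> carrier M" and s: "is_lub M s A" and yx: "y \<sqsubseteq>\<^bsub>M\<^esub> x" and ys: "y \<sqsubseteq>\<^bsub>M\<^esub> s"
      and u: "u \<in> carrier M" and less: "\<And>a w. \<lbrakk>a \<in> A; w \<sqsubseteq>\<^bsub>M\<^esub> x; w \<sqsubseteq>\<^bsub>M\<^esub> a\<rbrakk> \<Longrightarrow> w \<sqsubseteq>\<^bsub>M\<^esub> u"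
    obtain B where B: "B \<subseteq> carrier L" "A = f ` B"
      using A unfolding im subset_image_iff by blast
    obtain x' where x': "x' \<in> carrier L" "x = f x'"
      using poset_le_closed[OF M yx] unfolding im by blast
    obtain y' where y': "y' \<in> carrier L" "y = f y'"
      using poset_le_closed[OF M yx] unfolding im by blast
    obtain u' where u': "u' \<in> carrier L" "u = f u'"
      using u unfolding im by blast
    note S = frame_Sup_closed[OF L B(1)]
    have "s = f (\<Squnion>\<^bsub>L\<^esub> B)"
      using poset_is_lub_Sup[OF M s] poset_is_lub_Sup[OF M lub[OF B(1)]] B(2) by simp
    then have "y' \<sqsubseteq>\<^bsub>L\<^esub> x'" "y' \<sqsubseteq>\<^bsub>L\<^esub> \<Squnion>\<^bsub>L\<^esub> B"
      using yx ys le[OF y'(1) x'(1)] le[OF y'(1) S] x'(2) y'(2) by simp_all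
    then have "y' \<sqsubseteq>\<^bsub>L\<^esub> x' \<sqinter>\<^bsub>L\<^esub> \<Squnion>\<^bsub>L\<^esub> B"
      using frame_meet[OF L x'(1) S] by blast
    moreover have "x' \<sqinter>\<^bsub>L\<^esub> \<Squnion>\<^bsub>L\<^esub> B \<sqsubseteq>\<^bsub>L\<^esub> u'"
    proof (rule frame_meet_Sup_le[OF L B(1) x'(1) u'(1)])
      fix b assume b: "b \<in> B"
      then have bc: "b \<in> carrier L"
        using B(1) by blast
      note m = frame_meet[OF L x'(1) bc]
      have "f (x' \<sqinter>\<^bsub>L\<^esub> b) \<sqsubseteq>\<^bsub>M\<^esub> u"
        using b m x' bc by (intro less[of "f b"]) (simp_all add: B(2) le)
      then show "x' \<sqinter>\<^bsub>L\<^esub> b \<sqsubseteq>\<^bsub>L\<^esub> u'"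
        using m u' by (simp add: le)
    qed
    ultimately have "y' \<sqsubseteq>\<^bsub>L\<^esub> u'"
      by (rule poset_trans[OF frame_poset[OF L]])
    then show "y \<sqsubseteq>\<^bsub>M\<^esub> u"
      using y' u' by (simp add: le)
  qed
  show "restrict f (carrier L) \<in> frame_homs L M"
    unfolding frame_homs_def
  proof (intro CollectI conjI ballI allI impI)
    show "restrict f (carrier L) \<in> carrier L \<rightarrow>\<^sub>E carrier M"
      using im by auto
    show "restrict f (carrier L) \<top>\<^bsub>L\<^esub> = \<top>\<^bsub>M\<^esub>"
      using frame_top[OF L] by (intro HOL.sym[OF poset_top_eqI[OF M]]) (auto simp: im le)
    show "restrict f (carrier L) (x \<sqinter>\<^bsub>L\<^esub> y)
        = restrict f (carrier L) x \<sqinter>\<^bsub>M\<^esub> restrict f (carrier L) y"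
      if x: "x \<in> carrier L" and y: "y \<in> carrier L" for x y
    proof -
      note m = frame_meet[OF L x y]
      have "f x \<sqinter>\<^bsub>M\<^esub> f y = f (x \<sqinter>\<^bsub>L\<^esub> y)"
      proof (rule poset_meet_eqI[OF M])
        fix w assume w: "w \<sqsubseteq>\<^bsub>M\<^esub> f x" "w \<sqsubseteq>\<^bsub>M\<^esub> f y"
        then obtain w' where "w' \<in> carrier L" "w = f w'"
          using poset_le_closed[OF M w(1)] unfolding im by blast
        then show "w \<sqsubseteq>\<^bsub>M\<^esub> f (x \<sqinter>\<^bsub>L\<^esub> y)"
          using w m x y by (simp add: le)
      qed (use m x y im in \<open>simp_all add: le\<close>)
      then show ?thesis
        using m x y by simp
    qed
    show "restrict f (carrier L) (\<Squnion>\<^bsub>L\<^esub> A) = \<Squnion>\<^bsub>M\<^esub> (restrict f (carrier L) ` A)"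
      if A: "A \<subseteq> carrier L" for A
    proof -
      have "\<Squnion>\<^bsub>M\<^esub> (f ` A) = f (\<Squnion>\<^bsub>L\<^esub> A)"
        by (rule poset_is_lub_Sup[OF M lub[OF A]])
      moreover have "restrict f (carrier L) ` A = f ` A"
        using A by (intro image_cong) auto
      ultimately show ?thesis
        using frame_Sup_closed[OF L A] by simp
    qed
  qed
qed

lemma transport_carrier: "carrier (transport e P) = e ` carrier P"
  by (simp add: transport_def)

lemma transport_le:
  assumes "inj_on e (carrier P)" "x \<in> carrier P" "y \<in> carrier P"
  shows "e x \<sqsubseteq>\<^bsub>transport e P\<^esub> e y \<longleftrightarrow> x \<sqsubseteq>\<^bsub>P\<^esub> y"
  using assms by (auto simp: transport_def dest: inj_onD)

lemma poset_transport:
  assumes e: "inj_on e (carrier P)" and P: "poset P"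
  shows "poset (transport e P)"
proof (rule posetI)
  have D: "\<exists>a \<in> carrier P. \<exists>b \<in> carrier P. x = e a \<and> y = e b \<and> a \<sqsubseteq>\<^bsub>P\<^esub> b"
    if "x \<sqsubseteq>\<^bsub>transport e P\<^esub> y" for x y
    using that by (simp add: transport_def)
  show "x \<in> carrier (transport e P) \<and> y \<in> carrier (transport e P)"
    if "x \<sqsubseteq>\<^bsub>transport e P\<^esub> y" for x y
    using D[OF that] unfolding transport_carrier by blast
  show "x \<sqsubseteq>\<^bsub>transport e P\<^esub> x" if "x \<in> carrier (transport e P)" for x
    using that poset_refl[OF P] transport_le[OF e] unfolding transport_carrier by blast
  show "x = y" if xy: "x \<sqsubseteq>\<^bsub>transport e P\<^esub> y" "y \<sqsubseteq>\<^bsub>transport e P\<^esub> x" for x y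
  proof -
    obtain a b where ab: "a \<in> carrier P" "b \<in> carrier P" "x = e a" "y = e b" "a \<sqsubseteq>\<^bsub>P\<^esub> b"
      using D[OF xy(1)] by blast
    then have "b \<sqsubseteq>\<^bsub>P\<^esub> a"
      using xy(2) transport_le[OF e] by blast
    then show "x = y"
      using ab poset_antisym[OF P] by blast
  qed
  show "x \<sqsubseteq>\<^bsub>transport e P\<^esub> z" if xyz: "x \<sqsubseteq>\<^bsub>transport e P\<^esub> y" "y \<sqsubseteq>\<^bsub>transport e P\<^esub> z" for x y z
  proof -
    obtain a b where ab: "a \<in> carrier P" "b \<in> carrier P" "x = e a" "y = e b" "a \<sqsubseteq>\<^bsub>P\<^esub> b"
      using D[OF xyz(1)] by blast
    obtain b' c where bc: "b' \<in> carrier P" "c \<in> carrier P" "y = e b'" "z = e c" "b' \<sqsubseteq>\<^bsub>P\<^esub> c"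
      using D[OF xyz(2)] by blast
    have "b' = b"
      using ab bc inj_onD[OF e] by metis
    then have "a \<sqsubseteq>\<^bsub>P\<^esub> c"
      using ab bc poset_trans[OF P] by blast
    then show ?thesis
      using ab bc transport_le[OF e] by blast
  qed
qed (simp add: transport_def)

lemma
  assumes e: "inj_on e (carrier P)" and P: "frame P"
  shows frame_transport: "frame (transport e P)"
    and transport_frame_hom: "restrict e (carrier P) \<in> frame_homs P (transport e P)"
    and transport_inv_frame_hom:
      "restrict (inv_into (carrier P) e) (e ` carrier P) \<in> frame_homs (transport e P) P"
proof -
  note T = poset_transport[OF e frame_poset[OF P]]
  have bij: "bij_betw e (carrier P) (carrier (transport e P))"
    using e by (simp add: bij_betw_def transport_carrier)
  show F: "frame (transport e P)"
    by (rule order_iso_frame(1)[OF P T bij transport_le[OF e]])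
  show "restrict e (carrier P) \<in> frame_homs P (transport e P)"
    by (rule order_iso_frame(2)[OF P T bij transport_le[OF e]])
  have "inv_into (carrier P) e x \<sqsubseteq>\<^bsub>P\<^esub> inv_into (carrier P) e y \<longleftrightarrow> x \<sqsubseteq>\<^bsub>transport e P\<^esub> y"
    if "x \<in> carrier (transport e P)" "y \<in> carrier (transport e P)" for x y
    using that transport_le[OF e] inv_into_f_f[OF e] by (auto simp: transport_carrier)
  from order_iso_frame(2)[OF F frame_poset[OF P] bij_betw_inv_into[OF bij] this]
  show "restrict (inv_into (carrier P) e) (e ` carrier P) \<in> frame_homs (transport e P) P"
    by (simp add: transport_carrier)
qed

lemma transport_map_apply:
  "inj_on e (carrier P) \<Longrightarrow> x \<in> carrier P \<Longrightarrow> transport_map e P e' h (e x) = e' (h x)"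
  by (simp add: transport_map_def)

lemma transport_map_frame_hom:
  assumes e: "inj_on e (carrier P)" and P: "frame P"
    and e': "inj_on e' (carrier Q)" and Q: "frame Q" and h: "h \<in> frame_homs P Q"
  shows "transport_map e P e' h \<in> frame_homs (transport e P) (transport e' Q)"
proof -
  let ?i = "restrict (inv_into (carrier P) e) (e ` carrier P)"
  have F: "frame (transport e P)"
    by (rule frame_transport[OF e P])
  \<comment> \<open>The transported map is the composite of \<open>h\<close> with the inverse of \<open>e\<close> and with \<open>e'\<close>.\<close>
  have "compose (carrier (transport e P)) (restrict e' (carrier Q)) (compose (carrier (transport e P)) h ?i)
      \<in> frame_homs (transport e P) (transport e' Q)"
    by (rule frame_hom_compose[OF F frame_hom_compose[OF F transport_inv_frame_hom[OF e P] h]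
          transport_frame_hom[OF e' Q]])
  also have "compose (carrier (transport e P)) (restrict e' (carrier Q)) (compose (carrier (transport e P)) h ?i)
      = transport_map e P e' h"
    unfolding transport_map_def compose_def transport_carrier
    by (rule restrict_ext) (auto simp: e frame_hom_closed[OF h])
  finally show ?thesis .
qed

context subcanonical_site
begin

lemma frame_homs_transport_eq_on_principals:
  assumes e: "inj_on e (carrier (Id_frame C J))"
    and h: "h \<in> frame_homs (transport e (Id_frame C J)) L"
    and k: "k \<in> frame_homs (transport e (Id_frame C J)) L"
    and eq: "\<And>c. c \<in> carrier C \<Longrightarrow> h (e (principal C c)) = k (e (principal C c))"
  shows "h = k"
proof (rule extensionalityI[OF frame_hom_extensional[OF h] frame_hom_extensional[OF k]])
  let ?e = "restrict e (carrier (Id_frame C J))"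
  note he = frame_hom_compose[OF frame_Id_frame transport_frame_hom[OF e frame_Id_frame] h]
  note ke = frame_hom_compose[OF frame_Id_frame transport_frame_hom[OF e frame_Id_frame] k]
  have "compose (carrier (Id_frame C J)) h ?e = compose (carrier (Id_frame C J)) k ?e" (is "?l = ?r")
    using eq principal_ideal
    by (intro frame_homs_eq_on_principals[OF he ke]) (simp add: compose_eq Id_frame_carrier)
  then have "?l I = ?r I" for I
    by (rule fun_cong)
  then have "h (e I) = k (e I)" if "I \<in> carrier (Id_frame C J)" for I
    using that compose_eq[OF that, of _ ?e] by (metis restrict_apply')
  then show "h x = k x" if "x \<in> carrier (transport e (Id_frame C J))" for x
    using that by (auto simp: transport_carrier)
qed

text \<open>
  The inverse bijection is the extension \<open>I \<mapsto> \<Squnion> f(I)\<close>, precomposed with the inverse of \<open>e\<close>. The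
  universal property is stated for a transported copy because that copy, with the ideals encoded as
  elements of the type of \<open>C\<close>, is the value of the left adjoint at \<open>C\<close>.
\<close>

theorem bij_betw_restrict_principal:
  assumes e: "inj_on e (carrier (Id_frame C J))" and L: "frame L"
  shows "bij_betw (\<lambda>h. \<lambda>c \<in> carrier C. h (e (principal C c)))
    (frame_homs (transport e (Id_frame C J)) L) (cover_preserving_filtering C J L)"
    (is "bij_betw ?\<phi> (frame_homs ?F L) _")
proof (rule bij_betw_imageI)
  show "inj_on ?\<phi> (frame_homs ?F L)"
  proof (rule inj_onI)
    fix h k assume h: "h \<in> frame_homs ?F L" and k: "k \<in> frame_homs ?F L" and eq: "?\<phi> h = ?\<phi> k"
    show "h = k"
      using fun_cong[OF eq] by (intro frame_homs_transport_eq_on_principals[OF e h k]) (metis restrict_apply')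
  qed
  note F = frame_transport[OF e frame_Id_frame]
  have "?\<phi> h \<in> cover_preserving_filtering C J L" if h: "h \<in> frame_homs ?F L" for h
  proof -
    let ?he = "compose (carrier (Id_frame C J)) h (restrict e (carrier (Id_frame C J)))"
    have "?\<phi> h = compose (carrier C) ?he (\<lambda>c \<in> carrier C. principal C c)"
      unfolding compose_def using principal_ideal by (intro restrict_ext) (simp add: Id_frame_carrier)
    then show ?thesis
      using compose_frame_hom[OF frame_Id_frame L principal_cover_preserving_filtering
          frame_hom_compose[OF frame_Id_frame transport_frame_hom[OF e frame_Id_frame] h]] by simp
  qed
  moreover have "f \<in> ?\<phi> ` frame_homs ?F L" if f: "f \<in> cover_preserving_filtering C J L" for f
  proof
    let ?i = "restrict (inv_into (carrier (Id_frame C J)) e) (e ` carrier (Id_frame C J))"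
    let ?h = "compose (carrier ?F) (ideal_extension C J L f) ?i"
    show "?h \<in> frame_homs ?F L"
      by (rule frame_hom_compose[OF F transport_inv_frame_hom[OF e frame_Id_frame]
            ideal_extension_frame_hom[OF L f]])
    have "f \<in> extensional (carrier C)"
      using f by (auto simp: cover_preserving_filtering_def PiE_def)
    then show "f = ?\<phi> ?h"
    proof (rule extensionalityI[OF _ restrict_extensional])
      fix c assume c: "c \<in> carrier C"
      then have "principal C c \<in> carrier (Id_frame C J)"
        using principal_ideal by (simp add: Id_frame_carrier)
      then show "f c = ?\<phi> ?h c"
        using c ideal_extension_principal[OF L f c] by (simp add: compose_eq transport_carrier e)
    qed
  qed
  ultimately show "?\<phi> ` frame_homs ?F L = cover_preserving_filtering C J L"
    by blast
qed

end


section \<open>The adjunction\<close>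

lemma Frm_simps [simp]:
  "obj (Frm small) = {L. frame L \<and> small (carrier L)}"
  "arr (Frm small) = frame_homs"
  "idn (Frm small) C = restrict id (carrier C)"
  "cmp (Frm small) C D E g f = compose (carrier C) g f"
  by (simp_all add: Frm_def)

lemma forgetful_simps [simp]: "on_obj forgetful L = L" "on_arr forgetful L M f = f"
  by (simp_all add: forgetful_def)

lemma Id_functor_simps [simp]:
  "on_obj (Id_functor code J) C = transport code (Id_frame C (J C))"
  "on_arr (Id_functor code J) C D f
    = transport_map code (Id_frame C (J C)) code (Id_map C (J C) D (J D) f)"
  by (simp_all add: Id_functor_def)

theorem theorem6p4:
  fixes small :: "'a set \<Rightarrow> bool" and code :: "'a set \<Rightarrow> 'a"
    and Ob :: "'a gorder set"
    and J :: "'a gorder \<Rightarrow> 'a \<Rightarrow> 'a set set"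
    and H :: "'a gorder \<Rightarrow> 'a gorder \<Rightarrow> ('a \<Rightarrow> 'a) set"
  assumes universe: "universe small code"
    and category: "category (poset_cat Ob H)"
    and posets: "\<And>C. C \<in> Ob \<Longrightarrow> poset C \<and> small (carrier C)"
    and topologies: "\<And>C. C \<in> Ob \<Longrightarrow> grothendieck_topology C (J C) \<and> subcanonical C (J C)"
    and arrows: "\<And>C D. C \<in> Ob \<Longrightarrow> D \<in> Ob \<Longrightarrow> H C D \<subseteq> site_morphisms C (J C) D (J D)"
    and frames: "{L. frame L \<and> small (carrier L)} \<subseteq> Ob"
    and arrows_to_frames: "\<And>C L. C \<in> Ob \<Longrightarrow> L \<in> Ob \<Longrightarrow> frame L \<Longrightarrow>
      H C L = {f \<in> carrier C \<rightarrow>\<^sub>E carrier L. filtering C L f \<and> sends_covers_to_covers C (J C) L f}"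
  shows "left_adjoint (poset_cat Ob H) (Frm small) (Id_functor code J) forgetful"
proof -
  interpret K: category "poset_cat Ob H" by (rule category)
  interpret Frm: category "Frm small" by (rule category_Frm)
  let ?Id = "\<lambda>C. Id_frame C (J C)"
  let ?A = "\<lambda>C. transport code (?Id C)"
  let ?Am = "\<lambda>C D f. transport_map code (?Id C) code (Id_map C (J C) D (J D) f)"
  have sub: "subcanonical_site C (J C)" if "C \<in> Ob" for C
    using posets[OF that] topologies[OF that]
    by (simp add: subcanonical_site_def subcanonical_site_axioms_def site_def)
  then have site: "site C (J C)" if "C \<in> Ob" for C
    using that by (simp add: subcanonical_site_def)
  have homs: "H C L = cover_preserving_filtering C (J C) L" if "C \<in> Ob" "L \<in> Ob" "frame L" for C L
    using arrows_to_frames[OF that] by (simp add: cover_preserving_filtering_def)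
  have mor: "f \<in> site_morphisms C (J C) D (J D)" if "C \<in> Ob" "D \<in> Ob" "f \<in> H C D" for C D f
    using arrows that by blast
  have arr_closed: "f c \<in> carrier D" if "C \<in> Ob" "D \<in> Ob" "f \<in> H C D" "c \<in> carrier C" for C D f c
    using mor[OF that(1-3)] that(4) unfolding site_morphisms_def by blast
  have inj: "inj_on code (carrier (?Id C))" and small_A: "small (carrier (?A C))"
    and frame_A: "frame (?A C)" if C: "C \<in> Ob" for C
  proof -
    have c: "carrier (?Id C) \<subseteq> Pow (carrier C)"
      using site.ideal_subset[OF site[OF C]] by (auto simp: site.Id_frame_carrier[OF site[OF C]])
    have u: "inj_on code (Pow (carrier C))" "small (code ` Pow (carrier C))"
      using universe posets[OF C] unfolding universe_def by blast+
    show i: "inj_on code (carrier (?Id C))"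
      using u(1) c by (rule inj_on_subset)
    have "code ` carrier (?Id C) \<subseteq> code ` Pow (carrier C)"
      using c by (rule image_mono)
    then show "small (carrier (?A C))"
      using universe u(2) unfolding universe_def transport_carrier by blast
    show "frame (?A C)"
      by (rule frame_transport[OF i site.frame_Id_frame[OF site[OF C]]])
  qed
  have pr: "principal C c \<in> carrier (?Id C)" if "C \<in> Ob" "c \<in> carrier C" for C c
    using subcanonical_site.principal_ideal[OF sub] site.Id_frame_carrier[OF site] that by blast
  have code_pr: "code (principal C c) \<in> carrier (?A C)" if "C \<in> Ob" "c \<in> carrier C" for C c
    using pr[OF that] by (simp add: transport_carrier)
  have Am_hom: "?Am C D f \<in> frame_homs (?A C) (?A D)" if "C \<in> Ob" "D \<in> Ob" "f \<in> H C D" for C D f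
    by (rule transport_map_frame_hom[OF inj[OF that(1)] site.frame_Id_frame[OF site[OF that(1)]]
          inj[OF that(2)] site.frame_Id_frame[OF site[OF that(2)]]
          Id_map_frame_hom[OF site[OF that(1)] sub[OF that(2)] mor[OF that]]])
  \<comment> \<open>Homomorphisms out of \<open>A(C)\<close> agree if they agree on the principal ideals, so that functoriality
    and naturality are consequences of this equation.\<close>
  have Am_pr: "?Am C D f (code (principal C c)) = code (principal D (f c))"
    if "C \<in> Ob" "D \<in> Ob" "f \<in> H C D" "c \<in> carrier C" for C D f c
    by (simp only: transport_map_apply[OF inj[OF that(1)] pr[OF that(1,4)]]
        Id_map_principal[OF sub[OF that(1)] sub[OF that(2)] mor[OF that(1-3)] that(4)])
  have eqI: "h = k" if "C \<in> Ob" "h \<in> frame_homs (?A C) L" "k \<in> frame_homs (?A C) L"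
    "\<And>c. c \<in> carrier C \<Longrightarrow> h (code (principal C c)) = k (code (principal C c))" for C L h k
    by (rule subcanonical_site.frame_homs_transport_eq_on_principals[OF sub[OF that(1)] inj[OF that(1)] that(2-4)])
  have idn: "restrict id (carrier C) \<in> H C C" if "C \<in> Ob" for C
    using K.idn_arr[of C] that by simp
  have cmp: "compose (carrier C) g f \<in> H C E"
    if "C \<in> Ob" "D \<in> Ob" "E \<in> Ob" "f \<in> H C D" "g \<in> H D E" for C D E f g
    using K.cmp_arr[of C D E f g] that by simp
  have functor_A: "functor_between (poset_cat Ob H) (Frm small) (Id_functor code J)"
  proof (unfold_locales, unfold poset_cat_simps Frm_simps Id_functor_simps)
    fix C D E f g
    show "?A C \<in> {L. frame L \<and> small (carrier L)}" if "C \<in> Ob"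
      using that frame_A small_A by blast
    show "?Am C D f \<in> frame_homs (?A C) (?A D)" if "C \<in> Ob" "D \<in> Ob" "f \<in> H C D"
      by (rule Am_hom[OF that])
    show "?Am C C (restrict id (carrier C)) = restrict id (carrier (?A C))" if C: "C \<in> Ob"
      using code_pr[OF C] Am_pr[OF C C idn[OF C]]
      by (intro eqI[OF C Am_hom[OF C C idn[OF C]] frame_hom_id[OF frame_A[OF C]]]) simp
    show "?Am C E (compose (carrier C) g f) = compose (carrier (?A C)) (?Am D E g) (?Am C D f)"
      if C: "C \<in> Ob" and D: "D \<in> Ob" and E: "E \<in> Ob" and f: "f \<in> H C D" and g: "g \<in> H D E"
    proof (rule eqI[OF C Am_hom[OF C E cmp[OF C D E f g]]
            frame_hom_compose[OF frame_A[OF C] Am_hom[OF C D f] Am_hom[OF D E g]]])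
      fix c assume c: "c \<in> carrier C"
      show "?Am C E (compose (carrier C) g f) (code (principal C c))
          = compose (carrier (?A C)) (?Am D E g) (?Am C D f) (code (principal C c))"
        by (simp only: compose_eq[OF code_pr[OF C c]] compose_eq[OF c] Am_pr[OF C D f c]
            Am_pr[OF D E g arr_closed[OF C D f c]] Am_pr[OF C E cmp[OF C D E f g] c])
    qed
  qed
  have functor_U: "functor_between (Frm small) (poset_cat Ob H) forgetful"
  proof (unfold_locales, unfold poset_cat_simps Frm_simps forgetful_simps)
    fix L M f
    show "L \<in> Ob" if "L \<in> {L. frame L \<and> small (carrier L)}"
      using that frames by blast
    show "f \<in> H L M" if "L \<in> {L. frame L \<and> small (carrier L)}"
      "M \<in> {L. frame L \<and> small (carrier L)}" "f \<in> frame_homs L M"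
      using that frames subcanonical_site.frame_hom_cover_preserving_filtering[OF sub] homs by blast
  qed (rule refl)+
  let ?\<phi> = "\<lambda>C L h. \<lambda>c \<in> carrier C. h (code (principal C c))"
  have bij: "bij_betw (?\<phi> C L) (frame_homs (?A C) L) (H C L)"
    if "C \<in> Ob" "L \<in> {L. frame L \<and> small (carrier L)}" for C L
  proof -
    have "frame L" "L \<in> Ob"
      using that frames by blast+
    then show ?thesis
      using subcanonical_site.bij_betw_restrict_principal[OF sub inj] homs that(1) by simp
  qed
  have natural: "?\<phi> C' L' (compose (carrier (?A C')) g (compose (carrier (?A C')) h (?Am C' C f)))
      = compose (carrier C') g (compose (carrier C') (?\<phi> C L h) f)"
    if C: "C \<in> Ob" and C': "C' \<in> Ob" and f: "f \<in> H C' C" for C C' L L' f g h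
    unfolding compose_def[of "carrier C'"]
  proof (rule restrict_ext)
    fix c assume c: "c \<in> carrier C'"
    show "compose (carrier (?A C')) g (compose (carrier (?A C')) h (?Am C' C f)) (code (principal C' c))
        = g ((\<lambda>x \<in> carrier C'. ?\<phi> C L h (f x)) c)"
      using c arr_closed[OF C' C f c]
      by (simp add: compose_eq[OF code_pr[OF C' c]] Am_pr[OF C' C f c])
  qed
  show ?thesis
    unfolding left_adjoint_def
  proof (intro conjI functor_A functor_U exI[of _ ?\<phi>], unfold poset_cat_simps Frm_simps Id_functor_simps forgetful_simps)
    show "\<forall>C \<in> Ob. \<forall>L \<in> {L. frame L \<and> small (carrier L)}.
        bij_betw (?\<phi> C L) (frame_homs (?A C) L) (H C L)"
      using bij by blast
  qed (intro ballI natural)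
qed

end
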